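(* Let $\alpha\in(0,1)$, $p_0<0$, let $\rho\in C^{1,\alpha}([p_0,0];\mathbb{R}^+)$ be a nonincreasing streamline density function and $\beta\in C^{0,\alpha}([0,|p_0|];\mathbb{R})$ a Bernoulli function, and let $g>0$ and $Q\in\mathbb{R}$ be constants. Let $h\in C^{2,\alpha}(\overline{D})$, $2\pi$-periodic in $q$, with $h_p>0$ on $\overline{D}$, be a solution of the height-function problem $$ \begin{cases} (1+h_q^2)h_{pp}-2h_qh_ph_{qp}+h_p^2h_{qq}+[\beta(-p)-g(h-d)\rho'(p)]h_p^3=0 & \text{for } p_0<p<0,\\ 1+h_q^2+h_p^2\,(2g\rho(0) h-Q)=0 & \text{on } p=0,\\ h=0 & \text{on } p=p_0, \end{cases} $$ where $d=\frac1{2\pi}\int_{-\pi}^{\pi}h(q,0)\,dq$. Assume that every streamline is monotone between the successive trough and crest lines, with period $2\pi$, the crest line being $q=0$ and the trough lines $q=\pm\pi$; that is, for every $p\in[p_0,0]$ the function $q\mapsto h(q,p)$ is nondecreasing on $[-\pi,0]$ and nonincreasing on $[0,\pi]$, and moreover $h(\pm\pi,0)<h(q,0)$ for $-\pi<q<\pi$ (single trough per period on the surface). Then every streamline is symmetric about the crest line: $h(-q,p)=h(q,p)$ for all $q\in[-\pi,\pi]$ and $p\in[p_0,0]$.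
   Context: Steady two-dimensional continuously stratified periodic water waves over a flat bed $y=-d$ with free surface $y=\eta(x)$, where $\eta$ is $2\pi$-periodic with mean zero, are described in moving-frame coordinates. With pseudo-stream function $\psi$ (satisfying $\psi_x=-\sqrt\rho\,v$, $\psi_y=\sqrt\rho\,(u-c)<0$, $\psi=0$ on $y=\eta(x)$, $\psi=-p_0$ on $y=-d$), one sets $q=x$, $p=-\psi(x,y)$ and $h(q,p)=y+d$, the height above the flat bed. The fluid domain over one period becomes the rectangle $D=\{(q,p):-\pi<q<\pi,\ p_0<p<0\}$, with closure $\overline D$. The streamlines are the level sets of $p$: the streamline with label $p\in[p_0,0]$ is the graph $y=h(x,p)-d$, and $p=0$ is the free surface. The no-stagnation assumption $u<c$ is equivalent to $h_p>0$. The density is constant on streamlines and is given by $\rho=\rho(p)$, with $\rho'\le 0$; the Bernoulli function is evaluated at $-p$. *)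

theory Defs
  imports "HOL-Analysis.Analysis"
begin

text \<open>
  Partial derivative in direction \<open>b\<close> relative to a set \<open>S\<close>. At an interior point of \<open>S\<close> it is the
  usual partial derivative; at a boundary point of a nondegenerate interval or rectangle it is the
  (one-sided) derivative up to the boundary. Only values of \<open>f\<close> on \<open>S\<close> enter at points of \<open>S\<close>.
\<close>

definition partial_within ::
    "'a::euclidean_space set \<Rightarrow> 'a \<Rightarrow> ('a \<Rightarrow> real) \<Rightarrow> 'a \<Rightarrow> real" where
  "partial_within S b f x = frechet_derivative f (at x within S) b"

text \<open>
  The Hoelder class \<open>C\<^sup>k\<^sup>,\<^sup>\<alpha>(S)\<close> for a closed interval or rectangle \<open>S\<close>: \<open>f\<close> is \<open>k\<close> times
  differentiable up to the boundary and all its partial derivatives of order \<open>k\<close> are uniformly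
  Hoelder continuous with exponent \<open>\<alpha>\<close>. Continuity of the lower order derivatives follows from their
  differentiability, and boundedness from compactness of \<open>S\<close>.
\<close>

primrec holder_on :: "nat \<Rightarrow> real \<Rightarrow> 'a::euclidean_space set \<Rightarrow> ('a \<Rightarrow> real) \<Rightarrow> bool" where
  "holder_on 0 \<alpha> S f \<longleftrightarrow> (\<exists>C. \<forall>x\<in>S. \<forall>y\<in>S. \<bar>f x - f y\<bar> \<le> C * dist x y powr \<alpha>)"
| "holder_on (Suc k) \<alpha> S f \<longleftrightarrow>
     f differentiable_on S \<and> (\<forall>b\<in>Basis. holder_on k \<alpha> S (partial_within S b f))"

text \<open>Points are pairs \<open>(q, p)\<close>.\<close>

definition D :: "real \<Rightarrow> (real \<times> real) set" where
  "D p0 = {-pi<..<pi} \<times> {p0<..<0}"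

lemma closure_D: "p0 < 0 \<Longrightarrow> closure (D p0) = {-pi..pi} \<times> {p0..0}"
  unfolding D_def by (simp add: closure_Times)

definition dq :: "real \<Rightarrow> (real \<times> real \<Rightarrow> real) \<Rightarrow> real \<times> real \<Rightarrow> real" where
  "dq p0 = partial_within (closure (D p0)) (1, 0)"

definition dp :: "real \<Rightarrow> (real \<times> real \<Rightarrow> real) \<Rightarrow> real \<times> real \<Rightarrow> real" where
  "dp p0 = partial_within (closure (D p0)) (0, 1)"

definition mean_depth :: "(real \<times> real \<Rightarrow> real) \<Rightarrow> real" where
  "mean_depth h = 1 / (2 * pi) * integral {-pi..pi} (\<lambda>q. h (q, 0))"

text \<open>
  The mixed derivative \<open>h\<^sub>q\<^sub>p\<close> is \<open>dp p0 (dq p0 h)\<close>. The density derivative \<open>\<rho>'\<close> is only evaluated in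
  the open interval \<open>{p0<..<0}\<close>, so the ordinary \<open>deriv\<close> is appropriate for it.
\<close>

definition height_problem ::
    "real \<Rightarrow> (real \<Rightarrow> real) \<Rightarrow> (real \<Rightarrow> real) \<Rightarrow> real \<Rightarrow> real \<Rightarrow> (real \<times> real \<Rightarrow> real) \<Rightarrow> bool" where
  "height_problem p0 \<rho> \<beta> g Q h \<longleftrightarrow>
     (\<forall>(q, p)\<in>D p0.
        (1 + (dq p0 h (q, p))\<^sup>2) * dp p0 (dp p0 h) (q, p)
        - 2 * dq p0 h (q, p) * dp p0 h (q, p) * dp p0 (dq p0 h) (q, p)
        + (dp p0 h (q, p))\<^sup>2 * dq p0 (dq p0 h) (q, p)
        + (\<beta> (- p) - g * (h (q, p) - mean_depth h) * deriv \<rho> p) * (dp p0 h (q, p)) ^ 3 = 0) \<and>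
     (\<forall>q\<in>{-pi..pi}.
        1 + (dq p0 h (q, 0))\<^sup>2 + (dp p0 h (q, 0))\<^sup>2 * (2 * g * \<rho> 0 * h (q, 0) - Q) = 0) \<and>
     (\<forall>q\<in>{-pi..pi}. h (q, p0) = 0)"

end

theory Submission
  imports Defs
begin

text \<open>
  Moving planes in \<open>q\<close>. For \<open>-\<pi>/2 \<le> l \<le> 0\<close> put \<open>W\<^sub>l(q,p) = h(2l - q, p) - h(q,p)\<close> on \<open>-\<pi> \<le> q \<le> l\<close>.
  Monotonicity gives \<open>W\<^sub>l \<ge> 0\<close> for \<open>l = -\<pi>/2\<close>, and the inequality is propagated up to \<open>l = 0\<close>, where
  Hopf's lemma on the crest line forces \<open>W\<^sub>0 = 0\<close>. For \<open>l < 0\<close> the function \<open>W\<^sub>l\<close> is strictly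
  positive off \<open>q = l\<close> and off the bed: in the interior by the strong maximum principle, on the surface by
  Hopf's lemma and the surface condition, at the trough by the strict trough condition. Near the bed a
  maximum principle for thin strips keeps \<open>W\<^sub>l \<ge> 0\<close> when \<open>l\<close> grows. No corner lemma is needed, since
  \<open>W\<^sub>l(q,p) < 0\<close> can only happen when \<open>2l - q > 0\<close>, hence away from \<open>q = l\<close>.
\<close>

section \<open>Touching from below\<close>

text \<open>The coefficients of the height equation depend on \<open>p\<close> only and
  \<open>d\<close> is a fixed number, so reflecting or shifting \<open>h\<close> in \<open>q\<close>
  gives another solution. Subtracting two solutions leaves a linear differential inequality whose
  constant \<open>K\<close> is the same for all \<open>l\<close>. The density term gives it a zeroth
  order coefficient of the sign that spoils the usual maximum principle. This does no harm to
  functions already known to be nonnegative, which is all that the strong maximum principle and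
  Hopf's lemma deal with; only when \<open>l\<close> grows must a function of unknown sign be
  treated. The bed is the obstacle there: every \<open>W l\<close> vanishes on it, so compactness
  yields a positive lower bound only at a distance from it. The remaining strip can be chosen thin
  in terms of \<open>K\<close> before \<open>l\<close> moves.

  The range \<open>- pi / 2 \<le> l \<le> 0\<close> keeps the reflected point
  \<open>2 * l - q\<close> within one period, and at its left end \<open>q\<close> and
  \<open>2 * l - q\<close> both lie on the rising half, where monotonicity alone decides.\<close>

definition plane :: "real \<Rightarrow> real \<Rightarrow> real \<times> real \<Rightarrow> real" where
  "plane a b x = a * fst x + b * snd x"

lemma has_derivative_line:
  assumes "(f has_derivative plane a b) (at (x + t *\<^sub>R v))"
  shows "((\<lambda>t. f (x + t *\<^sub>R v)) has_real_derivative plane a b v) (at t)"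
proof -
  have "((\<lambda>t. x + t *\<^sub>R v) has_derivative (\<lambda>t. t *\<^sub>R v)) (at t)"
    by (auto intro!: derivative_eq_intros)
  from diff_chain_at[OF this assms]
  have "((\<lambda>t. f (x + t *\<^sub>R v)) has_derivative (\<lambda>t. plane a b (t *\<^sub>R v))) (at t)"
    by (simp add: o_def)
  moreover have "(\<lambda>t. plane a b (t *\<^sub>R v)) = (\<lambda>t. plane a b v * t)"
    by (auto simp: plane_def algebra_simps)
  ultimately show ?thesis by (simp add: has_field_derivative_def)
qed

text \<open>The second derivative is given at the single point 0, so no Taylor formula is used:
  \<open>s < 0\<close> would make \<open>f'\<close> negative just to the right of 0, and the mean
  value theorem would push \<open>f\<close> below its minimum.\<close>

lemma second_derivative_nonneg_at_min:
  fixes f f' :: "real \<Rightarrow> real"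
  assumes "d > 0" and f: "\<And>t. \<bar>t\<bar> < d \<Longrightarrow> (f has_real_derivative f' t) (at t)"
    and f': "(f' has_real_derivative s) (at 0)"
    and min: "\<And>t. \<bar>t\<bar> < d \<Longrightarrow> f 0 \<le> f t"
  shows "f' 0 = 0" "s \<ge> 0"
proof -
  show z: "f' 0 = 0"
    using DERIV_local_min[of f "f' 0" 0 d] f[of 0] min \<open>d > 0\<close> by auto
  show "s \<ge> 0"
  proof (rule ccontr)
    assume "\<not> s \<ge> 0"
    then obtain e where e: "e > 0" "\<And>h. h > 0 \<Longrightarrow> h < e \<Longrightarrow> f' h < 0"
      using has_real_derivative_neg_dec_right[of f' s 0 UNIV] f' z by auto
    define t where "t = min d e / 2"
    have t: "0 < t" "t < d" "t < e" using \<open>d > 0\<close> \<open>e > 0\<close> by (auto simp: t_def)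
    obtain \<xi> where "\<xi> > 0" "\<xi> < t" "f t - f 0 = (t - 0) * f' \<xi>"
      using MVT2[of 0 t f f'] f t by force
    moreover have "f' \<xi> < 0" using e calculation t by auto
    ultimately have "f t < f 0" using t by (smt (verit) mult_pos_neg)
    then show False using min[of t] t by auto
  qed
qed

text \<open>Restriction to lines through \<open>x\<close> reduces this to one variable. The common
  \<open>s12\<close> in both derivatives expresses the symmetry of the Hessian, and arbitrary
  \<open>v1\<close>, \<open>v2\<close> its positive semidefiniteness.\<close>

lemma second_order_min:
  assumes "open U" "x \<in> U"
    and f: "\<And>y. y \<in> U \<Longrightarrow> (f has_derivative plane (f1 y) (f2 y)) (at y)"
    and f1: "(f1 has_derivative plane s11 s12) (at x)"
    and f2: "(f2 has_derivative plane s12 s22) (at x)"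
    and min: "\<And>y. y \<in> U \<Longrightarrow> f x \<le> f y"
  shows "f1 x = 0" "f2 x = 0" "v1\<^sup>2 * s11 + 2 * v1 * v2 * s12 + v2\<^sup>2 * s22 \<ge> 0"
proof -
  have *: "f1 x * v1 + f2 x * v2 = 0 \<and> v1\<^sup>2 * s11 + 2 * v1 * v2 * s12 + v2\<^sup>2 * s22 \<ge> 0" for v1 v2
  proof -
    let ?v = "(v1, v2)"
    obtain e where e: "e > 0" "ball x e \<subseteq> U"
      using assms(1,2) openE by blast
    \<comment> \<open>The summand 1 keeps the quotient meaningful when the direction is
      zero.\<close>
    define d where "d = e / (1 + norm ?v)"
    have d: "d > 0" using e by (simp add: d_def add_pos_nonneg)
    have inU: "x + t *\<^sub>R ?v \<in> U" if "\<bar>t\<bar> < d" for t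
    proof -
      have "\<bar>t\<bar> * norm ?v \<le> \<bar>t\<bar> * (1 + norm ?v)" by (simp add: mult_left_mono)
      also have "\<dots> < e" using that unfolding d_def
        by (simp add: add_pos_nonneg pos_less_divide_eq)
      finally have "x + t *\<^sub>R ?v \<in> ball x e"
        unfolding mem_ball dist_norm by (metis add_diff_cancel_left' norm_minus_commute norm_scaleR)
      then show ?thesis using e(2) by blast
    qed
    let ?f' = "\<lambda>t. plane (f1 (x + t *\<^sub>R ?v)) (f2 (x + t *\<^sub>R ?v)) ?v"
    have D: "((\<lambda>t. f (x + t *\<^sub>R ?v)) has_real_derivative ?f' t) (at t)" if "\<bar>t\<bar> < d" for t
      by (rule has_derivative_line) (rule f[OF inU[OF that]])
    have 1: "((\<lambda>t. f1 (x + t *\<^sub>R ?v)) has_real_derivative plane s11 s12 ?v) (at 0)"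
      by (rule has_derivative_line) (use f1 in \<open>simp add: zero_prod_def[symmetric]\<close>)
    have 2: "((\<lambda>t. f2 (x + t *\<^sub>R ?v)) has_real_derivative plane s12 s22 ?v) (at 0)"
      by (rule has_derivative_line) (use f2 in \<open>simp add: zero_prod_def[symmetric]\<close>)
    have D2: "(?f' has_real_derivative (plane s11 s12 ?v * v1 + plane s12 s22 ?v * v2)) (at 0)"
      unfolding plane_def fst_conv snd_conv
      using DERIV_add[OF DERIV_cmult_right[OF 1, of v1] DERIV_cmult_right[OF 2, of v2]]
      unfolding plane_def fst_conv snd_conv .
    from second_derivative_nonneg_at_min[OF d D D2] min inU
    show ?thesis
      by (auto simp: plane_def algebra_simps power2_eq_square zero_prod_def[symmetric])
  qed
  show "f1 x = 0" "f2 x = 0" "v1\<^sup>2 * s11 + 2 * v1 * v2 * s12 + v2\<^sup>2 * s22 \<ge> 0"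
    using *[of 1 0] *[of 0 1] *[of v1 v2] by auto
qed

text \<open>The vector \<open>(v1, v2)\<close> stands for \<open>(h\<^sub>p, -h\<^sub>q)\<close>: the principal part of the height equation is
  \<open>\<partial>\<^sub>v\<^sup>2 + \<partial>\<^sub>p\<^sup>2\<close>. No sign is imposed on the zeroth order term.\<close>

definition ell :: "real \<Rightarrow> (real \<times> real) set \<Rightarrow> (real \<times> real \<Rightarrow> real) \<Rightarrow> bool" where
  "ell K U w \<longleftrightarrow> (\<exists>w1 w2. \<forall>z\<in>U. (w has_derivative plane (w1 z) (w2 z)) (at z) \<and>
     (\<exists>s11 s12 s22 v1 v2. (w1 has_derivative plane s11 s12) (at z) \<and>
        (w2 has_derivative plane s12 s22) (at z) \<and> 1 \<le> K * v1\<^sup>2 \<and> v1\<^sup>2 + v2\<^sup>2 \<le> K \<and>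
        \<bar>v1\<^sup>2 * s11 + 2 * v1 * v2 * s12 + v2\<^sup>2 * s22 + s22\<bar> \<le> K * (\<bar>w z\<bar> + \<bar>w1 z\<bar> + \<bar>w2 z\<bar>)))"

lemma ell_subset: "ell K U w \<Longrightarrow> V \<subseteq> U \<Longrightarrow> ell K V w"
  unfolding ell_def by (meson subset_iff)

text \<open>At a minimum of \<open>w - \<epsilon> * z\<close> the gradients agree and the principal
  part of \<open>w\<close> dominates that of \<open>\<epsilon> * z\<close>. The inequality for
  \<open>w\<close> bounds the former by the lower order terms of \<open>\<epsilon> * z\<close>,
  against the strict inequality \<open>sub\<close>. The minimum value may differ from 0, so the
  zeroth order term is controlled by the separate assumption \<open>le\<close>.\<close>

lemma ell_no_touching:
  assumes "open U" "ell K U w" "x \<in> U" "\<epsilon> > 0"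
    and z: "\<And>y. y \<in> U \<Longrightarrow> (z has_derivative plane (z1 y) (z2 y)) (at y)"
    and z1: "(z1 has_derivative plane t11 t12) (at x)"
    and z2: "(z2 has_derivative plane t12 t22) (at x)"
    and min: "\<And>y. y \<in> U \<Longrightarrow> w x - \<epsilon> * z x \<le> w y - \<epsilon> * z y"
    and le: "\<bar>w x\<bar> \<le> \<epsilon> * \<bar>z x\<bar>"
    and sub: "\<And>v1 v2. 1 \<le> K * v1\<^sup>2 \<Longrightarrow> v1\<^sup>2 + v2\<^sup>2 \<le> K \<Longrightarrow>
       K * (\<bar>z x\<bar> + \<bar>z1 x\<bar> + \<bar>z2 x\<bar>) < v1\<^sup>2 * t11 + 2 * v1 * v2 * t12 + v2\<^sup>2 * t22 + t22"
  shows False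
proof -
  obtain w1 w2 where w: "\<And>y. y \<in> U \<Longrightarrow> (w has_derivative plane (w1 y) (w2 y)) (at y)"
    and "\<exists>s11 s12 s22 v1 v2. (w1 has_derivative plane s11 s12) (at x) \<and>
        (w2 has_derivative plane s12 s22) (at x) \<and> 1 \<le> K * v1\<^sup>2 \<and> v1\<^sup>2 + v2\<^sup>2 \<le> K \<and>
        \<bar>v1\<^sup>2 * s11 + 2 * v1 * v2 * s12 + v2\<^sup>2 * s22 + s22\<bar> \<le> K * (\<bar>w x\<bar> + \<bar>w1 x\<bar> + \<bar>w2 x\<bar>)"
    using assms(2,3) unfolding ell_def by blast
  then obtain s11 s12 s22 v1 v2 where s1: "(w1 has_derivative plane s11 s12) (at x)"
    and s2: "(w2 has_derivative plane s12 s22) (at x)" and v: "1 \<le> K * v1\<^sup>2" "v1\<^sup>2 + v2\<^sup>2 \<le> K"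
    and ineq: "\<bar>v1\<^sup>2 * s11 + 2 * v1 * v2 * s12 + v2\<^sup>2 * s22 + s22\<bar>
               \<le> K * (\<bar>w x\<bar> + \<bar>w1 x\<bar> + \<bar>w2 x\<bar>)"
    by blast
  have K: "K > 0" using v by (smt (verit) mult_nonpos_nonneg zero_le_power2)
  have diff: "((\<lambda>y. f y - \<epsilon> * k y) has_derivative plane (a - \<epsilon> * c) (b - \<epsilon> * d)) (at y)"
    if "(f has_derivative plane a b) (at y)" "(k has_derivative plane c d) (at y)" for f k a b c d y
    using that unfolding plane_def
    by (auto intro!: derivative_eq_intros simp: algebra_simps)
  note m = second_order_min[where f = "\<lambda>y. w y - \<epsilon> * z y", OF assms(1,3) diff[OF w z] diff[OF s1 z1]
      diff[OF s2 z2] min]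
  have e1: "w1 x = \<epsilon> * z1 x" and e2: "w2 x = \<epsilon> * z2 x" using m(1,2) by auto
  have "v1\<^sup>2 * (s11 - \<epsilon> * t11) + 2 * v1 * v2 * (s12 - \<epsilon> * t12) + v2\<^sup>2 * (s22 - \<epsilon> * t22) \<ge> 0"
    by (rule m(3))
  moreover have "s22 - \<epsilon> * t22 \<ge> 0" using m(3)[of 0 1] by simp
  ultimately have "\<epsilon> * (v1\<^sup>2 * t11 + 2 * v1 * v2 * t12 + v2\<^sup>2 * t22 + t22) \<le>
    v1\<^sup>2 * s11 + 2 * v1 * v2 * s12 + v2\<^sup>2 * s22 + s22" by (simp add: algebra_simps)
  also have "\<dots> \<le> K * (\<bar>w x\<bar> + \<bar>w1 x\<bar> + \<bar>w2 x\<bar>)" using ineq by linarith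
  also have "\<dots> \<le> K * (\<epsilon> * \<bar>z x\<bar> + \<epsilon> * \<bar>z1 x\<bar> + \<epsilon> * \<bar>z2 x\<bar>)"
    using le K \<open>\<epsilon> > 0\<close> unfolding e1 e2 by (simp add: abs_mult)
  also have "\<dots> = \<epsilon> * (K * (\<bar>z x\<bar> + \<bar>z1 x\<bar> + \<bar>z2 x\<bar>))" by (simp add: algebra_simps)
  also have "\<dots> < \<epsilon> * (v1\<^sup>2 * t11 + 2 * v1 * v2 * t12 + v2\<^sup>2 * t22 + t22)"
    using sub[OF v] \<open>\<epsilon> > 0\<close> by simp
  finally show False by simp
qed

section \<open>Hopf's lemma and maximum principles\<close>

text \<open>This is uniform ellipticity of the principal part, whose quadratic form is the bracket
  on the right. The form controls \<open>x2\<close> directly, and \<open>x1\<close> through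
  \<open>v1 * x1 = (v1 * x1 + v2 * x2) - v2 * x2\<close>, because \<open>v1\<close> is bounded away
  from 0.\<close>

lemma elliptic_lower_bound:
  fixes v1 v2 x1 x2 K :: real
  assumes "1 \<le> K * v1\<^sup>2" "v1\<^sup>2 + v2\<^sup>2 \<le> K"
  shows "x1\<^sup>2 + x2\<^sup>2 \<le> (1 + 2 * K + 2 * K\<^sup>2) * ((v1 * x1 + v2 * x2)\<^sup>2 + x2\<^sup>2)"
proof -
  define E where "E = (v1 * x1 + v2 * x2)\<^sup>2 + x2\<^sup>2"
  have K: "K > 0" using assms by (smt (verit) mult_nonpos_nonneg zero_le_power2)
  have "(v1 * x1)\<^sup>2 = ((v1 * x1 + v2 * x2) - v2 * x2)\<^sup>2" by simp
  also have "\<dots> \<le> 2 * (v1 * x1 + v2 * x2)\<^sup>2 + 2 * (v2 * x2)\<^sup>2"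
    using zero_le_power2[of "(v1 * x1 + v2 * x2) + v2 * x2"]
    by (simp add: power2_eq_square algebra_simps)
  also have "\<dots> \<le> 2 * E + 2 * (K * E)"
  proof -
    have "v2\<^sup>2 \<le> K" using assms(2) by (smt (verit) zero_le_power2)
    then have "(v2 * x2)\<^sup>2 \<le> K * E" unfolding power_mult_distrib E_def
      using K by (intro mult_mono) auto
    moreover have "(v1 * x1 + v2 * x2)\<^sup>2 \<le> E" by (simp add: E_def)
    ultimately show ?thesis by linarith
  qed
  finally have 1: "v1\<^sup>2 * x1\<^sup>2 \<le> (2 + 2 * K) * E" by (simp add: power_mult_distrib algebra_simps)
  have "x1\<^sup>2 \<le> (K * v1\<^sup>2) * x1\<^sup>2" using assms(1) by (simp add: mult_le_cancel_right1)
  also have "\<dots> \<le> K * ((2 + 2 * K) * E)" using 1 K by simp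
  finally have "x1\<^sup>2 \<le> K * ((2 + 2 * K) * E)" .
  moreover have "x2\<^sup>2 \<le> E" by (simp add: E_def)
  ultimately show ?thesis unfolding E_def[symmetric] by (simp add: algebra_simps power2_eq_square)
qed

section \<open>The radial Gaussian barrier\<close>

context
  fixes a c1 c2 C :: real
begin

private definition "gau x = exp (- a * ((fst x - c1)\<^sup>2 + (snd x - c2)\<^sup>2))" for x :: "real \<times> real"

private lemma gau_deriv:
  "((\<lambda>x. gau x - C) has_derivative
      plane (- 2 * a * (fst y - c1) * gau y) (- 2 * a * (snd y - c2) * gau y)) (at y)"
  "((\<lambda>x. - 2 * a * (fst x - c1) * gau x) has_derivative
      plane ((4 * a\<^sup>2 * (fst y - c1)\<^sup>2 - 2 * a) * gau y)
        (4 * a\<^sup>2 * (fst y - c1) * (snd y - c2) * gau y)) (at y)"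
  "((\<lambda>x. - 2 * a * (snd x - c2) * gau x) has_derivative
      plane (4 * a\<^sup>2 * (fst y - c1) * (snd y - c2) * gau y)
        ((4 * a\<^sup>2 * (snd y - c2)\<^sup>2 - 2 * a) * gau y)) (at y)"
  unfolding gau_def plane_def
  by (auto intro!: derivative_eq_intros ext simp: algebra_simps power2_eq_square)

text \<open>Hopf's classical barrier. The second derivatives contain a term of order
  \<open>a\<^sup>2\<close> times the elliptic quadratic form of \<open>y - c\<close>, which stays
  away from 0 outside the half ball; \<open>big\<close> makes it beat all terms of order at most
  \<open>a\<close>. For \<open>z y \<ge> 0\<close> the sign of \<open>C\<close> gives the bound of
  \<open>\<bar>z y\<bar>\<close> by the Gaussian itself.\<close>

lemma barrier_exists:
  fixes K R :: real
  assumes "K \<ge> 1" "R > 0" "a > 0" "C \<ge> 0"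
    and big: "(1 + 2 * K + 2 * K\<^sup>2) * (2 * a * (K + 1) + K + 4 * a * R * K) < a\<^sup>2 * R\<^sup>2"
  obtains z z1 z2 where
    "\<And>x. z x = exp (- a * ((fst x - c1)\<^sup>2 + (snd x - c2)\<^sup>2)) - C"
    "\<And>y. (z has_derivative plane (z1 y) (z2 y)) (at y)"
    "\<And>y. dist (c1, c2) y < R \<Longrightarrow> R / 2 < dist (c1, c2) y \<Longrightarrow> z y \<ge> 0 \<Longrightarrow> \<exists>t11 t12 t22.
       (z1 has_derivative plane t11 t12) (at y) \<and> (z2 has_derivative plane t12 t22) (at y) \<and>
       (\<forall>v1 v2. 1 \<le> K * v1\<^sup>2 \<longrightarrow> v1\<^sup>2 + v2\<^sup>2 \<le> K \<longrightarrow>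
          K * (\<bar>z y\<bar> + \<bar>z1 y\<bar> + \<bar>z2 y\<bar>) < v1\<^sup>2 * t11 + 2 * v1 * v2 * t12 + v2\<^sup>2 * t22 + t22)"
proof
  fix y :: "real \<times> real"
  let ?z1 = "\<lambda>x. - 2 * a * (fst x - c1) * gau x"
  let ?z2 = "\<lambda>x. - 2 * a * (snd x - c2) * gau x"
  show "gau y - C = exp (- a * ((fst y - c1)\<^sup>2 + (snd y - c2)\<^sup>2)) - C"
    by (simp add: gau_def)
  show "((\<lambda>x. gau x - C) has_derivative plane (?z1 y) (?z2 y)) (at y)" by (rule gau_deriv)
  assume r: "dist (c1, c2) y < R" "R / 2 < dist (c1, c2) y" and pos: "gau y - C \<ge> 0"
  define x1 x2 where x: "x1 = fst y - c1" "x2 = snd y - c2"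
  have r2: "dist (c1, c2) y = sqrt (x1\<^sup>2 + x2\<^sup>2)"
    by (cases y) (simp add: dist_Pair_Pair dist_real_def x power2_commute)
  have "(R / 2)\<^sup>2 \<le> (dist (c1, c2) y)\<^sup>2"
    using r(2) assms(2) by (intro power_mono) auto
  then have R4: "R\<^sup>2 \<le> 4 * (x1\<^sup>2 + x2\<^sup>2)" unfolding r2 by (simp add: power_divide)
  have x1R: "\<bar>x1\<bar> \<le> R" "\<bar>x2\<bar> \<le> R"
    using r(1) real_sqrt_ge_abs1[of x1 x2] real_sqrt_ge_abs2[of x2 x1] unfolding r2 by linarith+
  have g: "gau y > 0" by (simp add: gau_def)
  let ?t11 = "(4 * a\<^sup>2 * x1\<^sup>2 - 2 * a) * gau y"
  let ?t12 = "4 * a\<^sup>2 * x1 * x2 * gau y"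
  let ?t22 = "(4 * a\<^sup>2 * x2\<^sup>2 - 2 * a) * gau y"
  have "K * (\<bar>gau y - C\<bar> + \<bar>?z1 y\<bar> + \<bar>?z2 y\<bar>) < v1\<^sup>2 * ?t11 + 2 * v1 * v2 * ?t12 + v2\<^sup>2 * ?t22 + ?t22"
    if v: "1 \<le> K * v1\<^sup>2" "v1\<^sup>2 + v2\<^sup>2 \<le> K" for v1 v2
  proof -
    define E where "E = (v1 * x1 + v2 * x2)\<^sup>2 + x2\<^sup>2"
    have "K * (\<bar>gau y - C\<bar> + \<bar>?z1 y\<bar> + \<bar>?z2 y\<bar>) \<le> K * (gau y + 2 * a * R * gau y + 2 * a * R * gau y)"
      using pos assms(1,3,4) g x1R unfolding x[symmetric]
      by (intro mult_left_mono add_mono) (auto simp: abs_mult)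
    also have "\<dots> = (K + 4 * a * R * K) * gau y" by (simp add: algebra_simps)
    also have "\<dots> < (4 * a\<^sup>2 * E - 2 * a * (v1\<^sup>2 + v2\<^sup>2 + 1)) * gau y"
    proof -
      let ?L = "1 + 2 * K + 2 * K\<^sup>2"
      have "?L * (2 * a * (K + 1) + K + 4 * a * R * K) < a\<^sup>2 * R\<^sup>2" by (rule big)
      also have "\<dots> \<le> a\<^sup>2 * (4 * (?L * E))"
      proof -
        have "R\<^sup>2 \<le> 4 * (?L * E)"
          using order_trans[OF R4 mult_left_mono[OF elliptic_lower_bound[OF v, of x1 x2], of 4]]
          unfolding E_def by simp
        then show ?thesis by (intro mult_left_mono) auto
      qed
      also have "\<dots> = ?L * (4 * a\<^sup>2 * E)" by simp
      finally have "2 * a * (K + 1) + K + 4 * a * R * K < 4 * a\<^sup>2 * E"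
        using assms(1) by (simp add: mult_less_cancel_left add_pos_nonneg)
      moreover have "2 * a * (v1\<^sup>2 + v2\<^sup>2 + 1) \<le> 2 * a * (K + 1)" using v assms(3) by simp
      ultimately show ?thesis using g by (intro mult_strict_right_mono) linarith+
    qed
    also have "\<dots> = v1\<^sup>2 * ?t11 + 2 * v1 * v2 * ?t12 + v2\<^sup>2 * ?t22 + ?t22"
      unfolding E_def by (simp add: algebra_simps power2_eq_square)
    finally show ?thesis .
  qed
  then show "\<exists>t11 t12 t22. (?z1 has_derivative plane t11 t12) (at y) \<and> (?z2 has_derivative plane t12 t22) (at y) \<and>
       (\<forall>v1 v2. 1 \<le> K * v1\<^sup>2 \<longrightarrow> v1\<^sup>2 + v2\<^sup>2 \<le> K \<longrightarrow>
          K * (\<bar>gau y - C\<bar> + \<bar>?z1 y\<bar> + \<bar>?z2 y\<bar>) < v1\<^sup>2 * t11 + 2 * v1 * v2 * t12 + v2\<^sup>2 * t22 + t22)"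
    using gau_deriv(2,3)[of y] unfolding x by blast
qed

end

text \<open>The barrier times the minimum \<open>m\<close> of \<open>w\<close> on the half ball lies
  below \<open>w\<close> there, since \<open>z \<le> 1\<close>, and on the sphere, where
  \<open>z = 0\<close>. A negative minimum of \<open>w - m * z\<close> would thus lie in the open
  annulus, with \<open>0 \<le> w < m * z\<close>, and is excluded by the touching argument. This
  comparison needs no sign of the zeroth order coefficient.\<close>

lemma hopf:
  fixes c :: "real \<times> real"
  assumes K: "K \<ge> 1" and R: "R > 0" and cont: "continuous_on (cball c R) w" and ell: "ell K (ball c R) w"
    and nonneg: "\<And>x. x \<in> cball c R \<Longrightarrow> 0 \<le> w x" and pos: "\<And>x. x \<in> ball c R \<Longrightarrow> 0 < w x"
  obtains \<kappa> where "\<kappa> > 0" "\<And>x. x \<in> cball c R \<Longrightarrow> \<kappa> * (R - dist c x) \<le> w x"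
proof -
  obtain c1 c2 where c: "c = (c1, c2)" by fastforce
  define L where "L = 1 + 2 * K + 2 * K\<^sup>2"
  define N where "N = L * (2 * (K + 1) + K + 4 * R * K)"
  \<comment> \<open>With \<open>a \<ge> 1\<close> the left side of the barrier condition is at most
    \<open>a * N\<close>, so \<open>N < a * R\<^sup>2\<close> is enough.\<close>
  define a where "a = max 1 (N / R\<^sup>2 + 1)"
  have L: "L \<ge> 0" using K by (simp add: L_def)
  have a1: "a \<ge> 1" by (simp add: a_def)
  have a: "a > 0" "L * (2 * a * (K + 1) + K + 4 * a * R * K) < a\<^sup>2 * R\<^sup>2"
  proof -
    show "a > 0" using a1 by simp
    have "1 * K \<le> a * K" using a1 K by (intro mult_right_mono) auto
    then have "2 * a * (K + 1) + K + 4 * a * R * K \<le> a * (2 * (K + 1) + K + 4 * R * K)"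
      by (simp add: algebra_simps)
    then have "L * (2 * a * (K + 1) + K + 4 * a * R * K) \<le> L * (a * (2 * (K + 1) + K + 4 * R * K))"
      using L by (rule mult_left_mono)
    also have "\<dots> = a * N" by (simp add: N_def)
    also have "\<dots> < a * (a * R\<^sup>2)"
    proof -
      have "N / R\<^sup>2 < a" by (simp add: a_def)
      then have "N < a * R\<^sup>2" using R by (simp add: pos_divide_less_eq)
      then show ?thesis using a1 by (intro mult_strict_left_mono) auto
    qed
    finally show "L * (2 * a * (K + 1) + K + 4 * a * R * K) < a\<^sup>2 * R\<^sup>2"
      by (simp add: power2_eq_square)
  qed
  define C where "C = exp (- a * R\<^sup>2)"
  have "C \<ge> 0" by (simp add: C_def)
  obtain z z1 z2 where zdef: "\<And>x. z x = exp (- a * ((fst x - c1)\<^sup>2 + (snd x - c2)\<^sup>2)) - C"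
    and dz: "\<And>y. (z has_derivative plane (z1 y) (z2 y)) (at y)"
    and bar: "\<And>y. dist (c1, c2) y < R \<Longrightarrow> R / 2 < dist (c1, c2) y \<Longrightarrow> z y \<ge> 0 \<Longrightarrow> \<exists>t11 t12 t22.
       (z1 has_derivative plane t11 t12) (at y) \<and> (z2 has_derivative plane t12 t22) (at y) \<and>
       (\<forall>v1 v2. 1 \<le> K * v1\<^sup>2 \<longrightarrow> v1\<^sup>2 + v2\<^sup>2 \<le> K \<longrightarrow>
          K * (\<bar>z y\<bar> + \<bar>z1 y\<bar> + \<bar>z2 y\<bar>) < v1\<^sup>2 * t11 + 2 * v1 * v2 * t12 + v2\<^sup>2 * t22 + t22)"
    by (rule barrier_exists[OF K R a(1) \<open>C \<ge> 0\<close> a(2)[unfolded L_def], of c1 c2]) (rule that)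
  have zr: "z x = exp (- a * (dist c x)\<^sup>2) - C" for x
    by (cases x) (simp add: zdef c dist_Pair_Pair dist_real_def power2_commute)
  \<comment> \<open>With \<open>r = dist c x\<close>, this is \<open>exp t \<ge> 1 + t\<close> for
    \<open>t = a * (R\<^sup>2 - r\<^sup>2)\<close>, followed by
    \<open>R + r \<ge> R\<close>.\<close>
  have z_lower: "a * R * C * (R - dist c x) \<le> z x" if "x \<in> cball c R" for x
  proof -
    let ?r = "dist c x"
    have r: "0 \<le> ?r" "?r \<le> R" using that by auto
    have "a * R * C * (R - ?r) \<le> a * (R + ?r) * C * (R - ?r)"
      using r a \<open>C \<ge> 0\<close> by (intro mult_right_mono) auto
    also have "\<dots> = C * (a * R\<^sup>2 - a * ?r\<^sup>2)" by (simp add: algebra_simps power2_eq_square)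
    also have "\<dots> \<le> C * (exp (a * R\<^sup>2 - a * ?r\<^sup>2) - 1)"
      using \<open>C \<ge> 0\<close> exp_ge_add_one_self[of "a * R\<^sup>2 - a * ?r\<^sup>2"] by (intro mult_left_mono) linarith+
    also have "\<dots> = z x"
    proof -
      have "C * exp (a * R\<^sup>2 - a * ?r\<^sup>2) = exp (- a * ?r\<^sup>2)"
        unfolding C_def by (simp flip: exp_add)
      then show ?thesis unfolding zr by (simp add: right_diff_distrib)
    qed
    finally show ?thesis .
  qed
  have z_nonneg: "z x \<ge> 0" if "x \<in> cball c R" for x
  proof -
    have "0 \<le> a * R * C * (R - dist c x)" using that a R \<open>C \<ge> 0\<close> by (auto intro!: mult_nonneg_nonneg)
    then show ?thesis using z_lower[OF that] by linarith
  qed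
  have z_le: "z x \<le> 1" for x
  proof -
    have "exp (- a * (dist c x)\<^sup>2) \<le> 1" using a by simp
    then show ?thesis unfolding zr using \<open>C \<ge> 0\<close> by linarith
  qed
  have "compact (cball c (R/2))" "cball c (R/2) \<noteq> {}" using R by auto
  moreover have "continuous_on (cball c (R/2)) w"
    by (rule continuous_on_subset[OF cont]) (use R in auto)
  ultimately obtain x0 where x0: "x0 \<in> cball c (R/2)" "\<And>x. x \<in> cball c (R/2) \<Longrightarrow> w x0 \<le> w x"
    using continuous_attains_inf[of "cball c (R/2)" w] by metis
  define m where "m = w x0"
  have m: "m > 0" unfolding m_def using x0(1) R by (intro pos) auto
  have contz: "continuous_on S z" for S
    by (rule has_derivative_continuous_on) (rule has_derivative_at_withinI[OF dz])
  have "continuous_on (cball c R) (\<lambda>x. w x - m * z x)"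
    by (intro continuous_on_diff continuous_on_mult continuous_on_const cont contz)
  moreover have "compact (cball c R)" "cball c R \<noteq> {}" using R by auto
  ultimately obtain x where x: "x \<in> cball c R" "\<And>y. y \<in> cball c R \<Longrightarrow> w x - m * z x \<le> w y - m * z y"
    using continuous_attains_inf[of "cball c R" "\<lambda>x. w x - m * z x"] by metis
  have key: "w x - m * z x \<ge> 0"
  proof (rule ccontr)
    assume neg: "\<not> w x - m * z x \<ge> 0"
    have "dist c x \<noteq> R"
    proof
      assume "dist c x = R"
      then have "z x = 0" by (simp add: zr C_def)
      then show False using neg nonneg[OF x(1)] by simp
    qed
    moreover have "\<not> dist c x \<le> R / 2"
    proof
      assume "dist c x \<le> R / 2"
      then have "m \<le> w x" using x0 m_def by auto
      moreover have "m * z x \<le> m * 1" using z_le m by (intro mult_left_mono) auto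
      ultimately show False using neg by simp
    qed
    ultimately have r: "dist (c1, c2) x < R" "R / 2 < dist (c1, c2) x"
      using x(1) c by auto
    obtain t11 t12 t22 where t: "(z1 has_derivative plane t11 t12) (at x)"
      "(z2 has_derivative plane t12 t22) (at x)"
      "\<And>v1 v2. 1 \<le> K * v1\<^sup>2 \<Longrightarrow> v1\<^sup>2 + v2\<^sup>2 \<le> K \<Longrightarrow>
          K * (\<bar>z x\<bar> + \<bar>z1 x\<bar> + \<bar>z2 x\<bar>) < v1\<^sup>2 * t11 + 2 * v1 * v2 * t12 + v2\<^sup>2 * t22 + t22"
      using bar[OF r z_nonneg[OF x(1)]] by blast
    show False
    proof (rule ell_no_touching[OF open_ball ell _ m dz t(1,2) _ _ t(3)])
      show "x \<in> ball c R" using r c by simp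
      show "w x - m * z x \<le> w y - m * z y" if "y \<in> ball c R" for y
        using that by (intro x(2)) auto
      show "\<bar>w x\<bar> \<le> m * \<bar>z x\<bar>" using nonneg[OF x(1)] z_nonneg[OF x(1)] neg by simp
    qed
  qed
  show thesis
  proof
    show "m * (a * R * C) > 0" using m a R by (simp add: C_def)
    fix y assume y: "y \<in> cball c R"
    have "m * (a * R * C) * (R - dist c y) \<le> m * z y"
      using mult_left_mono[OF z_lower[OF y], of m] m by (simp add: algebra_simps)
    also have "\<dots> \<le> w y" using key x(2)[OF y] by linarith
    finally show "m * (a * R * C) * (R - dist c y) \<le> w y" .
  qed
qed

text \<open>Along the segment from \<open>x\<close> to the centre the linear growth of
  \<open>w\<close> becomes a positive lower bound for the derivative. The derivative is taken within
  the ball, so the lemma applies at boundary points of the rectangle, where \<open>h\<close> has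
  derivatives only from inside.\<close>

lemma hopf_derivative:
  assumes K: "K \<ge> 1" and R: "R > 0" and cont: "continuous_on (cball c R) w" and ell: "ell K (ball c R) w"
    and nonneg: "\<And>x. x \<in> cball c R \<Longrightarrow> 0 \<le> w x" and pos: "\<And>x. x \<in> ball c R \<Longrightarrow> 0 < w x"
    and x: "x \<in> sphere c R" "w x = 0" and D: "(w has_derivative w') (at x within cball c R)"
  shows "w' (c - x) > 0"
proof -
  obtain \<kappa> where \<kappa>: "\<kappa> > 0" "\<And>y. y \<in> cball c R \<Longrightarrow> \<kappa> * (R - dist c y) \<le> w y"
    using hopf[OF K R cont ell nonneg pos] by blast
  let ?g = "\<lambda>t::real. x + t *\<^sub>R (c - x)"
  have dist: "dist c (?g t) = (1 - t) * R" if "t \<in> {0..1}" for t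
  proof -
    have "c - ?g t = (1 - t) *\<^sub>R (c - x)" by (simp add: algebra_simps)
    then show ?thesis using that x by (simp add: dist_norm)
  qed
  have sub: "?g ` {0..1} \<subseteq> cball c R" using dist R by (auto simp: mult_le_cancel_right2)
  have "(?g has_derivative (\<lambda>t. t *\<^sub>R (c - x))) (at 0 within {0..1})"
    by (auto intro!: derivative_eq_intros)
  moreover have "(w has_derivative w') (at (?g 0) within ?g ` {0..1})"
    using has_derivative_subset[OF D sub] by simp
  ultimately have "((\<lambda>t. w (?g t)) has_derivative (\<lambda>t. w' (t *\<^sub>R (c - x)))) (at 0 within {0..1})"
    using diff_chain_within[of ?g _ 0 "{0..1}" w w'] by (simp add: o_def)
  then have "((\<lambda>t. w (?g t)) has_real_derivative w' (c - x)) (at 0 within {0..1})"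
    unfolding has_field_derivative_def
    by (rule has_derivative_eq_rhs) (use has_derivative_linear[OF D] in \<open>auto simp: linear_cmul mult.commute\<close>)
  then have lim: "((\<lambda>t. w (?g t) / t) \<longlongrightarrow> w' (c - x)) (at 0 within {0..1})"
    unfolding has_field_derivative_iff using x by simp
  have "\<kappa> * R \<le> w' (c - x)"
  proof (rule tendsto_lowerbound[OF lim])
    show "at 0 within {0..1::real} \<noteq> bot" by (simp add: trivial_limit_within islimpt_Icc)
    show "\<forall>\<^sub>F t in at 0 within {0..1}. \<kappa> * R \<le> w (?g t) / t"
      unfolding eventually_at_filter
    proof (intro always_eventually allI impI)
      fix t :: real assume t: "t \<noteq> 0" "t \<in> {0..1}"
      have "\<kappa> * (R - dist c (?g t)) \<le> w (?g t)" using \<kappa>(2) sub t by blast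
      then have "\<kappa> * R * t \<le> w (?g t)" unfolding dist[OF t(2)] by (simp add: algebra_simps)
      then show "\<kappa> * R \<le> w (?g t) / t" using t by (simp add: le_divide_eq)
    qed
  qed
  then show ?thesis using \<kappa> R by (smt (verit) mult_pos_pos)
qed

lemma ell_continuous_on: "ell K U w \<Longrightarrow> continuous_on U w"
  unfolding ell_def
  by (metis has_derivative_at_withinI has_derivative_continuous continuous_on_eq_continuous_within)

text \<open>The zero set is relatively closed, and it is open: around a nonzero point close to a
  zero, the largest ball free of zeros has a zero \<open>u\<close> on its sphere. There
  \<open>w\<close> has an interior minimum, so its gradient vanishes, contrary to Hopf's
  lemma.\<close>

lemma strong_maximum_principle:
  assumes K: "K \<ge> 1" and U: "open U" "connected U" and ell: "ell K U w"
    and nonneg: "\<And>x. x \<in> U \<Longrightarrow> 0 \<le> w x" and x: "x \<in> U" "w x = 0" and y: "y \<in> U"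
  shows "w y = 0"
proof -
  define Z where "Z = {x \<in> U. w x = 0}"
  have cont: "continuous_on U w" using ell by (rule ell_continuous_on)
  have closed: "closedin (top_of_set U) Z"
    unfolding Z_def by (rule continuous_closedin_preimage_constant[OF cont])
  have "open Z"
    unfolding open_contains_ball
  proof
    fix a assume a: "a \<in> Z"
    then obtain e where e: "e > 0" "cball a e \<subseteq> U"
      using U(1) open_contains_cball by (metis (no_types, lifting) Z_def mem_Collect_eq)
    \<comment> \<open>Half the radius ensures that the ball of radius \<open>e/2\<close> about
      \<open>b\<close> contains the zero \<open>a\<close> and still lies in
      \<open>U\<close>.\<close>
    have "b \<in> Z" if b: "b \<in> ball a (e/2)" for b
    proof (rule ccontr)
      assume "b \<notin> Z"
      have sub: "cball b (e/2) \<subseteq> U"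
      proof
        fix u assume "u \<in> cball b (e/2)"
        then have "u \<in> cball a e" using b dist_triangle[of a u b] by simp
        then show "u \<in> U" using e by blast
      qed
      let ?S = "{u \<in> cball b (e/2). w u = 0}"
      have "closed ?S"
        by (rule continuous_closed_preimage_constant) (simp_all add: continuous_on_subset[OF cont sub])
      moreover have "bounded ?S" by (rule bounded_subset[OF bounded_cball[of b "e/2"]]) auto
      ultimately have "compact ?S" by (simp add: compact_eq_bounded_closed)
      moreover have aS: "a \<in> ?S" using a b by (auto simp: Z_def dist_commute)
      ultimately obtain u where u: "u \<in> ?S" "\<And>s. s \<in> ?S \<Longrightarrow> dist b u \<le> dist b s"
        using distance_attains_inf[of ?S b] compact_imp_closed by blast
      define R where "R = dist b u"
      have "b \<in> U" by (rule subsetD[OF sub]) (use e(1) in simp)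
      then have "b \<noteq> u" using u(1) \<open>b \<notin> Z\<close> by (auto simp: Z_def)
      then have R: "R > 0" "R \<le> e/2" using u(1) by (auto simp: R_def)
      have subR: "cball b R \<subseteq> U" using sub R by auto
      have uU: "u \<in> U" using u(1) sub by blast
      obtain w1 w2 where D: "(w has_derivative plane (w1 u) (w2 u)) (at u)"
        using ell uU unfolding ell_def by blast
      have "plane (w1 u) (w2 u) = (\<lambda>v. 0)"
        by (rule differential_zero_maxmin[OF _ U(1) D]) (use uU u(1) nonneg in auto)
      moreover have "plane (w1 u) (w2 u) (b - u) > 0"
      proof (rule hopf_derivative[OF K R(1)])
        show "continuous_on (cball b R) w" by (rule continuous_on_subset[OF cont subR])
        show "ell K (ball b R) w"
          by (rule ell_subset[OF ell]) (use subR ball_subset_cball in blast)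
        show "0 \<le> w x" if "x \<in> cball b R" for x using that subR nonneg by blast
        show "0 < w x" if "x \<in> ball b R" for x
        proof -
          have "x \<in> U" using that subR ball_subset_cball by blast
          moreover have "w x \<noteq> 0"
            using u(2)[of x] that R unfolding R_def by auto
          ultimately show ?thesis using nonneg by (metis order_le_less)
        qed
        show "u \<in> sphere b R" "w u = 0" using u by (auto simp: R_def)
        show "(w has_derivative plane (w1 u) (w2 u)) (at u within cball b R)"
          using D by (rule has_derivative_at_withinI)
      qed
      ultimately show False by simp
    qed
    then show "\<exists>e>0. ball a e \<subseteq> Z" using e by (intro exI[of _ "e/2"]) auto
  qed
  then have "openin (top_of_set U) Z"
    using U(1) unfolding Z_def by (simp add: openin_open_eq)
  then have "Z = U" using closed U(2) x unfolding connected_clopen Z_def by blast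
  then show ?thesis using y Z_def by blast
qed

text \<open>Here the wrong sign of the zeroth order term is harmless, because the strip is thin:
  \<open>1 - K (p - p0)\<^sup>2\<close> is a positive strict supersolution.\<close>

lemma thin_strip_maximum_principle:
  assumes K: "K \<ge> 1" and "0 < \<delta>" "\<delta> \<le> 1 / (4 * K)" and "a < b"
    and cont: "continuous_on ({a..b} \<times> {p0..p0 + \<delta>}) w"
    and ell: "ell K ({a<..<b} \<times> {p0<..<p0 + \<delta>}) w"
    and bdry: "\<And>q p. q \<in> {a..b} \<Longrightarrow> p \<in> {p0..p0 + \<delta>} \<Longrightarrow> q = a \<or> q = b \<or> p = p0 \<or> p = p0 + \<delta> \<Longrightarrow> 0 \<le> w (q, p)"
    and "y \<in> {a..b} \<times> {p0..p0 + \<delta>}"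
  shows "0 \<le> w y"
proof -
  let ?C = "{a..b} \<times> {p0..p0 + \<delta>}" and ?U = "{a<..<b} \<times> {p0<..<p0 + \<delta>}"
  \<comment> \<open>This is the negative of the supersolution, so that a negative value of
    \<open>w\<close> is a positive multiple of \<open>z\<close>.\<close>
  define z where "z x = K * (snd x - p0)\<^sup>2 - 1" for x :: "real \<times> real"
  \<comment> \<open>The number 3/2 is 1 for \<open>\<bar>z x\<bar>\<close> plus 2 * 1/4 for the
    gradient; times \<open>K\<close> it stays below the second derivative \<open>2 * K\<close> of
    \<open>z\<close>.\<close>
  have small: "\<bar>z x\<bar> + 2 * K * \<bar>snd x - p0\<bar> \<le> 3/2" "z x < 0" if "x \<in> ?C" for x
  proof -
    have x: "0 \<le> snd x - p0" "snd x - p0 \<le> \<delta>" using that by auto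
    have Kd: "K * \<delta> \<le> 1/4" using assms(1,3) by (simp add: field_simps)
    have "K * (snd x - p0) \<le> 1/4" using x Kd K mult_left_mono[OF x(2), of K] by linarith
    moreover have "K * (snd x - p0)\<^sup>2 \<le> 1/4"
    proof -
      have "\<delta> \<le> 1" using Kd mult_right_mono[OF K, of \<delta>] \<open>0 < \<delta>\<close> by linarith
      then have "K * (snd x - p0) * (snd x - p0) \<le> (1/4) * 1"
        using x calculation K by (intro mult_mono) auto
      then show ?thesis by (simp add: power2_eq_square)
    qed
    moreover have "0 \<le> K * (snd x - p0)\<^sup>2" using K by simp
    ultimately show "\<bar>z x\<bar> + 2 * K * \<bar>snd x - p0\<bar> \<le> 3/2" "z x < 0" using x unfolding z_def by auto
  qed
  have contz: "continuous_on ?C z" unfolding z_def by (intro continuous_intros)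
  have "compact ?C" "?C \<noteq> {}" using assms(2,4) by (simp_all add: compact_Times)
  \<comment> \<open>Minimizing the quotient instead of \<open>w\<close> yields the largest
    supersolution multiple below \<open>w\<close>. If the minimum is negative,
    \<open>\<epsilon> * z\<close> touches \<open>w\<close> from below with equality.\<close>
  moreover have "continuous_on ?C (\<lambda>x. w x / - z x)"
    by (intro continuous_on_divide continuous_on_minus cont contz) (metis neg_0_equal_iff_equal order_less_irrefl small(2))
  ultimately obtain x where x: "x \<in> ?C" "\<And>y. y \<in> ?C \<Longrightarrow> w x / - z x \<le> w y / - z y"
    using continuous_attains_inf[of ?C "\<lambda>x. w x / - z x"] by metis
  have "w x \<ge> 0"
  proof (rule ccontr)
    assume neg: "\<not> 0 \<le> w x"
    obtain q p where qp: "x = (q, p)" by fastforce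
    then have "q \<in> {a..b}" "p \<in> {p0..p0 + \<delta>}" using x(1) by auto
    then have "\<not> (q = a \<or> q = b \<or> p = p0 \<or> p = p0 + \<delta>)" using neg bdry qp by blast
    then have xU: "x \<in> ?U" using x(1) qp by auto
    define \<epsilon> where "\<epsilon> = w x / z x"
    have \<epsilon>: "\<epsilon> > 0" "w x = \<epsilon> * z x"
      using neg small(2)[OF x(1)] by (auto simp: \<epsilon>_def zero_less_divide_iff)
    have dz: "(z has_derivative plane 0 (2 * K * (snd y - p0))) (at y)" for y
      unfolding z_def plane_def
      by (auto intro!: derivative_eq_intros simp: algebra_simps power2_eq_square)
    show False
    proof (rule ell_no_touching[OF _ ell xU \<epsilon>(1), where z = z and ?t11.0 = 0 and ?t12.0 = 0 and ?t22.0 = "2 * K"])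
      show "open ?U" by (simp add: open_Times)
      show "(z has_derivative plane 0 (2 * K * (snd y - p0))) (at y)" for y by (rule dz)
      show "((\<lambda>_. 0) has_derivative plane 0 0) (at x)" unfolding plane_def by simp
      show "((\<lambda>y. 2 * K * (snd y - p0)) has_derivative plane 0 (2 * K)) (at x)"
        unfolding plane_def by (auto intro!: derivative_eq_intros)
      show "w x - \<epsilon> * z x \<le> w y - \<epsilon> * z y" if "y \<in> ?U" for y
      proof -
        have y: "y \<in> ?C" using that by auto
        have "- \<epsilon> \<le> w y / - z y" using x(2)[OF y] by (simp add: \<epsilon>_def)
        then have "- \<epsilon> * (- z y) \<le> w y"
          using small(2)[OF y] pos_le_divide_eq[of "- z y" "- \<epsilon>" "w y"] by linarith
        then show ?thesis using \<epsilon>(2) by simp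
      qed
      show "\<bar>w x\<bar> \<le> \<epsilon> * \<bar>z x\<bar>" using \<epsilon> by (simp add: abs_mult)
      show "K * (\<bar>z x\<bar> + \<bar>0\<bar> + \<bar>2 * K * (snd x - p0)\<bar>) < v1\<^sup>2 * 0 + 2 * v1 * v2 * 0 + v2\<^sup>2 * (2 * K) + 2 * K" for v1 v2
      proof -
        have "K * (\<bar>z x\<bar> + \<bar>0\<bar> + \<bar>2 * K * (snd x - p0)\<bar>) \<le> K * (3/2)"
          using small(1)[OF x(1)] K by (intro mult_left_mono) (auto simp: abs_mult)
        also have "\<dots> < 2 * K" using K by simp
        also have "\<dots> \<le> v2\<^sup>2 * (2 * K) + 2 * K" using K by simp
        finally show ?thesis by simp
      qed
    qed
  qed
  then have "0 \<le> w x / - z x" using small(2)[OF x(1)] by (simp add: divide_nonneg_neg)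
  then have "0 \<le> w y / - z y" using x(2)[OF assms(8)] by linarith
  then show ?thesis using small(2)[OF assms(8)] pos_le_divide_eq[of "- z y" 0 "w y"] by linarith
qed

section \<open>Calculus and Hoelder functions\<close>

text \<open>One affine map covers the reflection of the moving planes (\<open>s = -1\<close>) and
  the shift used at the trough (\<open>s = 1\<close>).\<close>

lemma has_derivative_flip_shift:
  assumes "(f has_derivative plane a b) (at (s * fst z + t, snd z) within T)"
    and "(\<lambda>z. (s * fst z + t, snd z)) ` S \<subseteq> T"
  shows "((\<lambda>z. f (s * fst z + t, snd z)) has_derivative plane (s * a) b) (at z within S)"
proof -
  let ?\<sigma> = "\<lambda>z. (s * fst z + t, snd z)"
  have "(?\<sigma> has_derivative (\<lambda>v. (s * fst v, snd v))) (at z within S)"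
    by (auto intro!: derivative_eq_intros)
  moreover have "(f has_derivative plane a b) (at (?\<sigma> z) within ?\<sigma> ` S)"
    using assms by (rule has_derivative_subset)
  ultimately have "((\<lambda>z. f (?\<sigma> z)) has_derivative (\<lambda>v. plane a b (s * fst v, snd v))) (at z within S)"
    using diff_chain_within[of ?\<sigma> _ z S f] by (simp add: o_def)
  then show ?thesis by (rule has_derivative_eq_rhs) (auto simp: plane_def algebra_simps)
qed

lemma has_derivative_fst_line:
  assumes "(f has_derivative plane a b) (at (q, p) within S)"
    and "\<And>u. u \<in> T \<Longrightarrow> (u, p) \<in> S"
  shows "((\<lambda>u. f (u, p)) has_real_derivative a) (at q within T)"
proof -
  have "((\<lambda>u. (u, p)) has_derivative (\<lambda>u. (u, 0))) (at q within T)"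
    by (auto intro!: derivative_eq_intros)
  moreover have "(f has_derivative plane a b) (at (q, p) within (\<lambda>u. (u, p)) ` T)"
    using assms by (blast intro: has_derivative_subset)
  ultimately have "((\<lambda>u. f (u, p)) has_derivative (\<lambda>u. plane a b (u, 0))) (at q within T)"
    using diff_chain_within[of "\<lambda>u. (u, p)" _ q T f] by (simp add: o_def)
  then show ?thesis
    unfolding has_field_derivative_def by (rule has_derivative_eq_rhs) (auto simp: plane_def)
qed

lemma has_derivative_snd_line:
  assumes "(f has_derivative plane a b) (at (q, p))"
  shows "((\<lambda>u. f (q, u)) has_real_derivative b) (at p)"
proof -
  have "((\<lambda>u. (q, u)) has_derivative (\<lambda>u. (0, u))) (at p)"
    by (auto intro!: derivative_eq_intros)
  then have "((\<lambda>u. f (q, u)) has_derivative (\<lambda>u. plane a b (0, u))) (at p)"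
    using diff_chain_at[of "\<lambda>u. (q, u)" _ p f] assms by (simp add: o_def)
  then show ?thesis
    unfolding has_field_derivative_def by (rule has_derivative_eq_rhs) (auto simp: plane_def)
qed

text \<open>Clairaut's theorem: the mean value theorem, applied in both orders, evaluates the second
  difference over a small square as \<open>s * s\<close> times either mixed derivative at a nearby
  point.\<close>

lemma mixed_derivatives_eq:
  assumes U: "open U" "x \<in> U"
    and f: "\<And>y. y \<in> U \<Longrightarrow> (f has_derivative plane (f1 y) (f2 y)) (at y)"
    and f1: "\<And>y. y \<in> U \<Longrightarrow> (f1 has_derivative plane (f11 y) (f12 y)) (at y)"
    and f2: "\<And>y. y \<in> U \<Longrightarrow> (f2 has_derivative plane (f21 y) (f22 y)) (at y)"
    and cont: "continuous (at x) f12" "continuous (at x) f21"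
  shows "f12 x = f21 x"
proof (rule ccontr)
  assume ne: "f12 x \<noteq> f21 x"
  obtain q p where x: "x = (q, p)" by fastforce
  define \<epsilon> where "\<epsilon> = \<bar>f12 x - f21 x\<bar> / 2"
  have "\<epsilon> > 0" using ne by (simp add: \<epsilon>_def)
  obtain d0 where d0: "d0 > 0" "ball x d0 \<subseteq> U" using U openE by blast
  obtain d1 where d1: "d1 > 0" "\<And>y. dist y x < d1 \<Longrightarrow> dist (f12 y) (f12 x) < \<epsilon>"
    using cont(1) \<open>\<epsilon> > 0\<close> unfolding continuous_at_eps_delta by metis
  obtain d2 where d2: "d2 > 0" "\<And>y. dist y x < d2 \<Longrightarrow> dist (f21 y) (f21 x) < \<epsilon>"
    using cont(2) \<open>\<epsilon> > 0\<close> unfolding continuous_at_eps_delta by metis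
  \<comment> \<open>Points of the square are within \<open>2 * s\<close> of \<open>x\<close> by the
    sum norm; dividing by 3 makes this smaller than all three radii.\<close>
  define s where "s = min d0 (min d1 d2) / 3"
  have s: "s > 0" "2 * s < d0" "2 * s < d1" "2 * s < d2" using d0 d1 d2 by (auto simp: s_def)
  have near: "dist (u, v) x \<le> 2 * s" if "u \<in> {q..q + s}" "v \<in> {p..p + s}" for u v
  proof -
    have "dist (u, v) x = sqrt ((u - q)\<^sup>2 + (v - p)\<^sup>2)"
      by (simp add: x dist_Pair_Pair dist_real_def)
    also have "\<dots> \<le> \<bar>u - q\<bar> + \<bar>v - p\<bar>" by (rule sqrt_sum_squares_le_sum_abs)
    also have "\<dots> \<le> 2 * s" using that by auto
    finally show ?thesis .
  qed
  have inU: "(u, v) \<in> U" if "u \<in> {q..q + s}" "v \<in> {p..p + s}" for u v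
    using near[OF that] s d0(2) by (auto simp: dist_commute)
  let ?\<Delta> = "f (q + s, p + s) - f (q + s, p) - f (q, p + s) + f (q, p)"
  note fst_line = has_derivative_fst_line[where S = UNIV and T = UNIV, OF _ UNIV_I]
  note snd_line = has_derivative_snd_line
  have "\<exists>\<xi>. \<xi> > q \<and> \<xi> < q + s \<and>
     (f (q + s, p + s) - f (q + s, p)) - (f (q, p + s) - f (q, p)) = (q + s - q) * (f1 (\<xi>, p + s) - f1 (\<xi>, p))"
  proof (rule MVT2[where f = "\<lambda>u. f (u, p + s) - f (u, p)"])
    show "((\<lambda>u. f (u, p + s) - f (u, p)) has_real_derivative f1 (u, p + s) - f1 (u, p)) (at u)"
      if "q \<le> u" "u \<le> q + s" for u
      by (rule DERIV_diff; rule fst_line; rule f; rule inU) (use that s in auto)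
  qed (use s in simp)
  then obtain \<xi> where \<xi>: "\<xi> > q" "\<xi> < q + s" "?\<Delta> = s * (f1 (\<xi>, p + s) - f1 (\<xi>, p))" by auto
  have "\<exists>\<eta>. \<eta> > p \<and> \<eta> < p + s \<and> f1 (\<xi>, p + s) - f1 (\<xi>, p) = (p + s - p) * f12 (\<xi>, \<eta>)"
  proof (rule MVT2)
    show "((\<lambda>v. f1 (\<xi>, v)) has_real_derivative f12 (\<xi>, v)) (at v)" if "p \<le> v" "v \<le> p + s" for v
      by (rule snd_line, rule f1, rule inU) (use that \<xi> in auto)
  qed (use s in simp)
  then obtain \<eta> where \<eta>: "\<eta> > p" "\<eta> < p + s" "?\<Delta> = s * s * f12 (\<xi>, \<eta>)" using \<xi> by auto
  have "\<exists>\<eta>. \<eta> > p \<and> \<eta> < p + s \<and>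
     (f (q + s, p + s) - f (q, p + s)) - (f (q + s, p) - f (q, p)) = (p + s - p) * (f2 (q + s, \<eta>) - f2 (q, \<eta>))"
  proof (rule MVT2[where f = "\<lambda>v. f (q + s, v) - f (q, v)"])
    show "((\<lambda>v. f (q + s, v) - f (q, v)) has_real_derivative f2 (q + s, v) - f2 (q, v)) (at v)"
      if "p \<le> v" "v \<le> p + s" for v
      by (rule DERIV_diff; rule snd_line; rule f; rule inU) (use that s in auto)
  qed (use s in simp)
  then obtain \<eta>' where \<eta>': "\<eta>' > p" "\<eta>' < p + s" "?\<Delta> = s * (f2 (q + s, \<eta>') - f2 (q, \<eta>'))" by auto
  have "\<exists>\<xi>. \<xi> > q \<and> \<xi> < q + s \<and> f2 (q + s, \<eta>') - f2 (q, \<eta>') = (q + s - q) * f21 (\<xi>, \<eta>')"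
  proof (rule MVT2[where f = "\<lambda>u. f2 (u, \<eta>')"])
    show "((\<lambda>u. f2 (u, \<eta>')) has_real_derivative f21 (u, \<eta>')) (at u)" if "q \<le> u" "u \<le> q + s" for u
      by (rule fst_line, rule f2, rule inU) (use that \<eta>' in auto)
  qed (use s in simp)
  then obtain \<xi>' where \<xi>': "\<xi>' > q" "\<xi>' < q + s" "?\<Delta> = s * s * f21 (\<xi>', \<eta>')" using \<eta>' by auto
  have "f12 (\<xi>, \<eta>) = f21 (\<xi>', \<eta>')" using \<eta>(3) \<xi>'(3) s(1) by simp
  moreover have "dist (f12 (\<xi>, \<eta>)) (f12 x) < \<epsilon>"
    using near[of \<xi> \<eta>] \<xi> \<eta> s by (intro d1(2)) auto
  moreover have "dist (f21 (\<xi>', \<eta>')) (f21 x) < \<epsilon>"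
    using near[of \<xi>' \<eta>'] \<xi>' \<eta>' s by (intro d2(2)) auto
  moreover have "dist (f12 x) (f21 x) \<le> dist (f12 (\<xi>, \<eta>)) (f12 x) + dist (f12 (\<xi>, \<eta>)) (f21 x)"
    by (rule dist_triangle3)
  moreover have "dist (f12 x) (f21 x) = 2 * \<epsilon>" by (simp add: \<epsilon>_def dist_real_def)
  ultimately show False by simp
qed

section \<open>Linearization of the height equation\<close>

lemma abs_mult_le:
  fixes x y a b :: real
  shows "\<bar>x\<bar> \<le> a \<Longrightarrow> \<bar>y\<bar> \<le> b \<Longrightarrow> \<bar>x * y\<bar> \<le> a * b"
  unfolding abs_mult by (rule mult_mono) auto

lemma abs_add_le:
  fixes x y a b :: real
  shows "\<bar>x\<bar> \<le> a \<Longrightarrow> \<bar>y\<bar> \<le> b \<Longrightarrow> \<bar>x + y\<bar> \<le> a + b"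
  by linarith

lemma abs_diff_le:
  fixes x y a b :: real
  shows "\<bar>x\<bar> \<le> a \<Longrightarrow> \<bar>y\<bar> \<le> b \<Longrightarrow> \<bar>x - y\<bar> \<le> a + b"
  by linarith

text \<open>The second order coefficients are frozen at \<open>h\<close>. What is left of the
  difference of the two equations is a combination of \<open>kq - hq\<close>, \<open>kp - hp\<close>
  and \<open>k - h\<close>, with the second derivatives of \<open>k\<close> absorbed in bounded
  coefficients. The worst coefficient is \<open>C\<close>, at most
  \<open>4 * B\<^sup>2 + 3 * B ^ 3 + 3 * B ^ 4\<close>, whence the factor 10.\<close>

lemma linearization_bound:
  fixes h hq hp hqq hqp hpp k kq kp kqq kqp kpp b r d B :: real
  assumes h: "(1 + hq\<^sup>2) * hpp - 2 * hq * hp * hqp + hp\<^sup>2 * hqq + (b - r * (h - d)) * hp ^ 3 = 0"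
    and k: "(1 + kq\<^sup>2) * kpp - 2 * kq * kp * kqp + kp\<^sup>2 * kqq + (b - r * (k - d)) * kp ^ 3 = 0"
    and B: "B \<ge> 1" "\<bar>h - d\<bar> \<le> B" "\<bar>b\<bar> \<le> B" "\<bar>r\<bar> \<le> B" "\<bar>hq\<bar> \<le> B" "\<bar>hp\<bar> \<le> B"
      "\<bar>kq\<bar> \<le> B" "\<bar>kp\<bar> \<le> B" "\<bar>kqq\<bar> \<le> B" "\<bar>kqp\<bar> \<le> B" "\<bar>kpp\<bar> \<le> B"
  shows "\<bar>hp\<^sup>2 * (kqq - hqq) + 2 * hp * (- hq) * (kqp - hqp) + (- hq)\<^sup>2 * (kpp - hpp) + (kpp - hpp)\<bar>
    \<le> 10 * B ^ 4 * (\<bar>k - h\<bar> + \<bar>kq - hq\<bar> + \<bar>kp - hp\<bar>)" (is "\<bar>?E\<bar> \<le> _")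
proof -
  \<comment> \<open>\<open>S\<close> is the quotient of \<open>kp ^ 3 - hp ^ 3\<close> by
    \<open>kp - hp\<close>; \<open>A\<close>, \<open>C\<close> and \<open>G\<close> multiply the
    differences of \<open>q\<close>-derivatives, of \<open>p\<close>-derivatives and of
    heights.\<close>
  define S where "S = kp * kp + kp * hp + hp * hp"
  define A where "A = 2 * (kqp * hp) - (kq + hq) * kpp"
  define C where "C = 2 * (kqp * kq) - (kp + hp) * kqq - b * S + r * (h - d) * S"
  define G where "G = r * (kp * (kp * kp))"
  have "?E - (A * (kq - hq) + C * (kp - hp) + G * (k - h)) =
      ((1 + kq\<^sup>2) * kpp - 2 * kq * kp * kqp + kp\<^sup>2 * kqq + (b - r * (k - d)) * kp ^ 3)
      - ((1 + hq\<^sup>2) * hpp - 2 * hq * hp * hqp + hp\<^sup>2 * hqq + (b - r * (h - d)) * hp ^ 3)"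
    unfolding A_def C_def G_def S_def by (simp add: algebra_simps power2_eq_square power3_eq_cube)
  then have E: "?E = A * (kq - hq) + C * (kp - hp) + G * (k - h)" using h k by simp
  have pow: "B * B \<le> B ^ 4" "B * (B * B) \<le> B ^ 4"
    using B(1) power_increasing[of 2 4 B] power_increasing[of 3 4 B]
    by (auto simp: power2_eq_square power3_eq_cube)
  have "\<bar>S\<bar> \<le> B * B + B * B + B * B"
    unfolding S_def by (intro abs_add_le abs_mult_le B)
  then have S: "\<bar>S\<bar> \<le> 3 * (B * B)" by simp
  have "\<bar>A\<bar> \<le> 2 * (B * B) + (B + B) * B"
    unfolding A_def by (intro abs_add_le abs_diff_le abs_mult_le B) simp
  then have A: "\<bar>A\<bar> \<le> 10 * B ^ 4" using pow B(1) by (simp add: algebra_simps)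
  have "\<bar>C\<bar> \<le> 2 * (B * B) + (B + B) * B + B * (3 * (B * B)) + B * B * (3 * (B * B))"
    unfolding C_def by (intro abs_add_le abs_diff_le abs_mult_le B S) simp
  moreover have "B * B * (3 * (B * B)) = 3 * B ^ 4" by (simp add: power4_eq_xxxx)
  ultimately have C: "\<bar>C\<bar> \<le> 10 * B ^ 4" using pow by (simp add: algebra_simps)
  have "\<bar>G\<bar> \<le> B * (B * (B * B))"
    unfolding G_def by (intro abs_mult_le B)
  then have G: "\<bar>G\<bar> \<le> 10 * B ^ 4" using B(1) by (simp add: power4_eq_xxxx mult.assoc)
  have "\<bar>?E\<bar> \<le> \<bar>A * (kq - hq)\<bar> + \<bar>C * (kp - hp)\<bar> + \<bar>G * (k - h)\<bar>" unfolding E by linarith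
  also have "\<dots> \<le> 10 * B ^ 4 * \<bar>kq - hq\<bar> + 10 * B ^ 4 * \<bar>kp - hp\<bar> + 10 * B ^ 4 * \<bar>k - h\<bar>"
    by (intro add_mono abs_mult_le A C G) auto
  also have "\<dots> = 10 * B ^ 4 * (\<bar>k - h\<bar> + \<bar>kq - hq\<bar> + \<bar>kp - hp\<bar>)" by (simp add: algebra_simps)
  finally show ?thesis .
qed

section \<open>From Hoelder classes to continuous partial derivatives\<close>

lemma holder_on_0_continuous_on:
  assumes "\<alpha> > 0" "holder_on 0 \<alpha> S f"
  shows "continuous_on S f"
proof -
  obtain C where C: "\<And>x y. x \<in> S \<Longrightarrow> y \<in> S \<Longrightarrow> \<bar>f x - f y\<bar> \<le> C * dist x y powr \<alpha>"
    using assms(2) by auto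
  show ?thesis
    unfolding continuous_on_def
  proof
    fix x assume x: "x \<in> S"
    have "((\<lambda>y. dist y x) \<longlongrightarrow> dist x x) (at x within S)"
      by (intro tendsto_intros)
    then have "((\<lambda>y. dist y x powr \<alpha>) \<longlongrightarrow> 0) (at x within S)"
      using assms(1) by (intro tendsto_zero_powrI) auto
    then have "((\<lambda>y. C * dist y x powr \<alpha>) \<longlongrightarrow> 0) (at x within S)"
      by (rule tendsto_mult_right_zero)
    moreover have "\<forall>\<^sub>F y in at x within S. norm (f y - f x) \<le> C * dist y x powr \<alpha>"
      using C x by (auto simp: eventually_at_filter)
    ultimately have "((\<lambda>y. f y - f x) \<longlongrightarrow> 0) (at x within S)"
      by (rule Lim_null_comparison[rotated])
    then show "(f \<longlongrightarrow> f x) (at x within S)" by (simp add: LIM_zero_iff)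
  qed
qed

lemma differentiable_on_has_derivative_plane:
  fixes f :: "real \<times> real \<Rightarrow> real"
  assumes "f differentiable_on S" "z \<in> S"
  shows "(f has_derivative plane (partial_within S (1, 0) f z) (partial_within S (0, 1) f z)) (at z within S)"
proof -
  let ?D = "frechet_derivative f (at z within S)"
  have D: "(f has_derivative ?D) (at z within S)"
    using assms unfolding differentiable_on_def by (simp add: frechet_derivative_works)
  have "?D v = plane (partial_within S (1, 0) f z) (partial_within S (0, 1) f z) v" for v
  proof -
    have "v = fst v *\<^sub>R (1, 0) + snd v *\<^sub>R (0, 1)" by (simp add: prod_eq_iff)
    then have "?D v = ?D (fst v *\<^sub>R (1, 0) + snd v *\<^sub>R (0, 1))" by (rule arg_cong)
    also have "\<dots> = fst v *\<^sub>R ?D (1, 0) + snd v *\<^sub>R ?D (0, 1)"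
      by (simp only: linear_add[OF has_derivative_linear[OF D]] linear_cmul[OF has_derivative_linear[OF D]])
    finally have "?D v = fst v *\<^sub>R ?D (1, 0) + snd v *\<^sub>R ?D (0, 1)" .
    then show ?thesis by (simp add: plane_def partial_within_def mult.commute)
  qed
  then have "?D = plane (partial_within S (1, 0) f z) (partial_within S (0, 1) f z)" by (rule ext)
  with D show ?thesis by simp
qed

section \<open>Moving planes\<close>

lemma cball_subset_box:
  fixes a b r :: real
  shows "cball (a, b) r \<subseteq> {a - r..a + r} \<times> {b - r..b + r}"
proof
  fix z assume "z \<in> cball (a, b) r"
  then have "dist a (fst z) \<le> r" "dist b (snd z) \<le> r"
    using dist_fst_le[of "(a, b)" z] dist_snd_le[of "(a, b)" z] by auto
  then show "z \<in> {a - r..a + r} \<times> {b - r..b + r}"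
    by (cases z) (auto simp: dist_real_def)
qed

lemma ball_subset_box:
  fixes a b r :: real
  shows "ball (a, b) r \<subseteq> {a - r<..<a + r} \<times> {b - r<..<b + r}"
proof
  fix z assume "z \<in> ball (a, b) r"
  then have "dist a (fst z) < r" "dist b (snd z) < r"
    using dist_fst_le[of "(a, b)" z] dist_snd_le[of "(a, b)" z] by auto
  then show "z \<in> {a - r<..<a + r} \<times> {b - r<..<b + r}"
    by (cases z) (auto simp: dist_real_def)
qed

lemma zero_on_closed_box:
  fixes f :: "real \<times> real \<Rightarrow> real"
  assumes "continuous_on ({a..b} \<times> {c..d}) f" "a < b" "c < d"
    and "\<And>z. z \<in> {a<..<b} \<times> {c<..<d} \<Longrightarrow> f z = 0" and "z \<in> {a..b} \<times> {c..d}"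
  shows "f z = 0"
proof -
  have "closure ({a<..<b} \<times> {c<..<d}) = {a..b} \<times> {c..d}"
    using assms(2,3) by (simp add: closure_Times)
  then show ?thesis
    using continuous_constant_on_closure[of "{a<..<b} \<times> {c<..<d}" f 0 z] assms(1,4,5) by simp
qed

text \<open>The problem in classical terms: first derivatives up to the boundary, second ones inside
  with a common bound. In the application \<open>b p\<close> is \<open>\<beta> (- p)\<close>,
  \<open>r\<close> is \<open>g\<close> times the density derivative and \<open>r0\<close> is
  \<open>2 * g * \<rho> 0\<close>. The shared \<open>h12\<close> records equality of the mixed
  derivatives, and \<open>\<nu>\<close> is the uniform form of the no-stagnation condition.\<close>

locale monotone_wave =
  fixes p0 Q d r0 B \<nu> :: real and b r :: "real \<Rightarrow> real"
    and h h1 h2 h11 h12 h22 :: "real \<times> real \<Rightarrow> real"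
  assumes p0: "p0 < 0" and B: "B \<ge> 1" and \<nu>: "\<nu> > 0"
    and dh: "\<And>z. z \<in> {-pi..pi} \<times> {p0..0} \<Longrightarrow>
      (h has_derivative plane (h1 z) (h2 z)) (at z within {-pi..pi} \<times> {p0..0})"
    and dh1: "\<And>z. z \<in> {-pi<..<pi} \<times> {p0<..<0} \<Longrightarrow> (h1 has_derivative plane (h11 z) (h12 z)) (at z)"
    and dh2: "\<And>z. z \<in> {-pi<..<pi} \<times> {p0<..<0} \<Longrightarrow> (h2 has_derivative plane (h12 z) (h22 z)) (at z)"
    and bounds: "\<And>z. z \<in> {-pi<..<pi} \<times> {p0<..<0} \<Longrightarrow> \<bar>h z - d\<bar> \<le> B \<and> \<bar>h1 z\<bar> \<le> B \<and> \<bar>h2 z\<bar> \<le> B \<and>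
      \<bar>h11 z\<bar> \<le> B \<and> \<bar>h12 z\<bar> \<le> B \<and> \<bar>h22 z\<bar> \<le> B"
    and coeff_bounds: "\<And>p. p \<in> {p0<..<0} \<Longrightarrow> \<bar>b p\<bar> \<le> B \<and> \<bar>r p\<bar> \<le> B"
    and h2_lower: "\<And>z. z \<in> {-pi..pi} \<times> {p0..0} \<Longrightarrow> \<nu> \<le> h2 z"
    and eqn: "\<And>z. z \<in> {-pi<..<pi} \<times> {p0<..<0} \<Longrightarrow>
      (1 + (h1 z)\<^sup>2) * h22 z - 2 * h1 z * h2 z * h12 z + (h2 z)\<^sup>2 * h11 z
        + (b (snd z) - r (snd z) * (h z - d)) * h2 z ^ 3 = 0"
    and surface: "\<And>q. q \<in> {-pi..pi} \<Longrightarrow> 1 + (h1 (q, 0))\<^sup>2 + (h2 (q, 0))\<^sup>2 * (r0 * h (q, 0) - Q) = 0"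
    and bed: "\<And>q. q \<in> {-pi..pi} \<Longrightarrow> h (q, p0) = 0"
    and periodic: "\<And>p. p \<in> {p0..0} \<Longrightarrow> h (-pi, p) = h (pi, p)"
    and mono: "\<And>p q q'. p \<in> {p0..0} \<Longrightarrow> -pi \<le> q \<Longrightarrow> q \<le> q' \<Longrightarrow> q' \<le> 0 \<Longrightarrow> h (q, p) \<le> h (q', p)"
    and antimono: "\<And>p q q'. p \<in> {p0..0} \<Longrightarrow> 0 \<le> q \<Longrightarrow> q \<le> q' \<Longrightarrow> q' \<le> pi \<Longrightarrow> h (q', p) \<le> h (q, p)"
    and trough: "\<And>q. -pi < q \<Longrightarrow> q < pi \<Longrightarrow> h (-pi, 0) < h (q, 0)"
begin

section \<open>Ellipticity of differences and strictness at the trough\<close>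

definition "K = 10 * B ^ 4 + 1 / \<nu>\<^sup>2"

lemma K: "K \<ge> 1" "K \<ge> 10 * B ^ 4"
proof -
  have "1 \<le> B ^ 4" using B by (rule one_le_power)
  moreover have "0 \<le> 1 / \<nu>\<^sup>2" by simp
  ultimately show "K \<ge> 1" "K \<ge> 10 * B ^ 4" unfolding K_def by linarith+
qed

lemma dh_interior:
  assumes "z \<in> {-pi<..<pi} \<times> {p0<..<0}"
  shows "(h has_derivative plane (h1 z) (h2 z)) (at z)"
proof -
  have "z \<in> interior ({-pi..pi} \<times> {p0..0})" using assms by (simp add: interior_Times)
  then have "at z within {-pi..pi} \<times> {p0..0} = at z" by (rule at_within_interior)
  moreover have "z \<in> {-pi..pi} \<times> {p0..0}" using assms by auto
  ultimately show ?thesis using dh[of z] by simp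
qed

text \<open>Under reflection both \<open>h1\<close> and \<open>h12\<close> change sign, and they
  enter the equation only as a square and as a product, so it is preserved. In \<open>K\<close>, the
  summand \<open>1 / \<nu>\<^sup>2\<close> gives the lower bound for \<open>v1 = h2 z\<close>, and
  \<open>10 * B ^ 4\<close> covers the linearization and the size of
  \<open>(v1, v2)\<close>.\<close>

lemma ell_difference:
  assumes s: "s = 1 \<or> s = -1" and U: "U \<subseteq> {-pi<..<pi} \<times> {p0<..<0}"
    and \<sigma>U: "\<And>z. z \<in> U \<Longrightarrow> (s * fst z + t, snd z) \<in> {-pi<..<pi} \<times> {p0<..<0}"
  shows "ell K U (\<lambda>z. h (s * fst z + t, snd z) - h z)"
  unfolding ell_def
proof (intro exI ballI conjI)
  let ?\<sigma> = "\<lambda>z::real\<times>real. (s * fst z + t, snd z)"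
  let ?w1 = "\<lambda>z. s * h1 (?\<sigma> z) - h1 z"
  let ?w2 = "\<lambda>z. h2 (?\<sigma> z) - h2 z"
  fix z assume z: "z \<in> U"
  have zO: "z \<in> {-pi<..<pi} \<times> {p0<..<0}" using z U by blast
  then have sz: "snd z \<in> {p0<..<0}" by auto
  note \<sigma>O = \<sigma>U[OF z]
  have diff: "((\<lambda>z. c * f (?\<sigma> z) - f z) has_derivative plane (c * s * a' - a) (c * b' - b)) (at z)"
    if "(f has_derivative plane a' b') (at (?\<sigma> z))" "(f has_derivative plane a b) (at z)" for f a a' b b' c
  proof -
    have "((\<lambda>z. f (?\<sigma> z)) has_derivative plane (s * a') b') (at z)"
      using that(1) by (rule has_derivative_flip_shift) simp
    with that(2) show ?thesis
      unfolding plane_def by (auto intro!: derivative_eq_intros simp: algebra_simps)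
  qed
  have s2: "s * s = 1" using s by auto
  show "((\<lambda>z. h (?\<sigma> z) - h z) has_derivative plane (?w1 z) (?w2 z)) (at z)"
    using diff[OF dh_interior[OF \<sigma>O] dh_interior[OF zO], of 1] by simp
  show "(?w1 has_derivative plane (h11 (?\<sigma> z) - h11 z) (s * h12 (?\<sigma> z) - h12 z)) (at z)"
    using diff[OF dh1[OF \<sigma>O] dh1[OF zO], of s] by (simp add: s2)
  show "(?w2 has_derivative plane (s * h12 (?\<sigma> z) - h12 z) (h22 (?\<sigma> z) - h22 z)) (at z)"
    using diff[OF dh2[OF \<sigma>O] dh2[OF zO], of 1] by simp
  have zR: "z \<in> {-pi..pi} \<times> {p0..0}" using zO by auto
  have "1 = 1 / \<nu>\<^sup>2 * \<nu>\<^sup>2" using \<nu> by simp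
  also have "\<dots> \<le> K * (h2 z)\<^sup>2"
    using h2_lower[OF zR] \<nu> B by (intro mult_mono power_mono) (auto simp: K_def)
  finally show "1 \<le> K * (h2 z)\<^sup>2" .
  have "(h2 z)\<^sup>2 \<le> B\<^sup>2" "(- h1 z)\<^sup>2 \<le> B\<^sup>2"
    using bounds[OF zO] B by (simp_all add: abs_le_square_iff[symmetric])
  moreover have "B\<^sup>2 \<le> B ^ 4" "0 \<le> B ^ 4" using B by (auto intro: power_increasing)
  ultimately show "(h2 z)\<^sup>2 + (- h1 z)\<^sup>2 \<le> K" using K(2) by linarith
  have sh1: "\<bar>s * h1 (?\<sigma> z)\<bar> = \<bar>h1 (?\<sigma> z)\<bar>" "(s * h1 (?\<sigma> z))\<^sup>2 = (h1 (?\<sigma> z))\<^sup>2"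
    "\<bar>s * h12 (?\<sigma> z)\<bar> = \<bar>h12 (?\<sigma> z)\<bar>"
    "2 * (s * h1 (?\<sigma> z)) * h2 (?\<sigma> z) * (s * h12 (?\<sigma> z)) = 2 * h1 (?\<sigma> z) * h2 (?\<sigma> z) * h12 (?\<sigma> z)"
    using s by auto
  have "\<bar>(h2 z)\<^sup>2 * (h11 (?\<sigma> z) - h11 z) + 2 * h2 z * (- h1 z) * (s * h12 (?\<sigma> z) - h12 z)
      + (- h1 z)\<^sup>2 * (h22 (?\<sigma> z) - h22 z) + (h22 (?\<sigma> z) - h22 z)\<bar>
    \<le> 10 * B ^ 4 * (\<bar>h (?\<sigma> z) - h z\<bar> + \<bar>?w1 z\<bar> + \<bar>?w2 z\<bar>)"
  proof (rule linearization_bound)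
    show "(1 + (h1 z)\<^sup>2) * h22 z - 2 * h1 z * h2 z * h12 z + (h2 z)\<^sup>2 * h11 z
        + (b (snd z) - r (snd z) * (h z - d)) * h2 z ^ 3 = 0" by (rule eqn[OF zO])
    show "(1 + (s * h1 (?\<sigma> z))\<^sup>2) * h22 (?\<sigma> z) - 2 * (s * h1 (?\<sigma> z)) * h2 (?\<sigma> z) * (s * h12 (?\<sigma> z))
        + (h2 (?\<sigma> z))\<^sup>2 * h11 (?\<sigma> z) + (b (snd z) - r (snd z) * (h (?\<sigma> z) - d)) * h2 (?\<sigma> z) ^ 3 = 0"
      unfolding sh1 using eqn[OF \<sigma>O] by simp
  qed (simp_all only: sh1 B bounds[OF zO] bounds[OF \<sigma>O] coeff_bounds[OF sz])
  also have "\<dots> \<le> K * (\<bar>h (?\<sigma> z) - h z\<bar> + \<bar>?w1 z\<bar> + \<bar>?w2 z\<bar>)"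
    using K(2) by (intro mult_right_mono) auto
  finally show "\<bar>(h2 z)\<^sup>2 * (h11 (?\<sigma> z) - h11 z) + 2 * h2 z * (- h1 z) * (s * h12 (?\<sigma> z) - h12 z)
      + (- h1 z)\<^sup>2 * (h22 (?\<sigma> z) - h22 z) + (h22 (?\<sigma> z) - h22 z)\<bar>
    \<le> K * (\<bar>h (?\<sigma> z) - h z\<bar> + \<bar>?w1 z\<bar> + \<bar>?w2 z\<bar>)" .
qed

lemma cont_h: "continuous_on ({-pi..pi} \<times> {p0..0}) h"
  by (rule has_derivative_continuous_on) (rule dh)

lemma uniform_h:
  assumes "e > 0"
  obtains \<delta> where "\<delta> > 0" "\<And>q q' p. q \<in> {-pi..pi} \<Longrightarrow> q' \<in> {-pi..pi} \<Longrightarrow> p \<in> {p0..0} \<Longrightarrow>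
    \<bar>q' - q\<bar> < \<delta> \<Longrightarrow> \<bar>h (q', p) - h (q, p)\<bar> < e"
proof -
  have "compact ({-pi..pi} \<times> {p0..0})" by (intro compact_Times compact_Icc)
  then have "uniformly_continuous_on ({-pi..pi} \<times> {p0..0}) h"
    using cont_h compact_uniformly_continuous by blast
  then obtain \<delta> where \<delta>: "\<delta> > 0" "\<And>z z'. z \<in> {-pi..pi} \<times> {p0..0} \<Longrightarrow> z' \<in> {-pi..pi} \<times> {p0..0} \<Longrightarrow>
    dist z' z < \<delta> \<Longrightarrow> dist (h z') (h z) < e"
    using assms unfolding uniformly_continuous_on_def by metis
  show thesis
    by (rule that[OF \<delta>(1)]) (use \<delta>(2) in \<open>force simp: dist_real_def dist_Pair_Pair\<close>)
qed

lemma min_at_trough: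
  assumes "p \<in> {p0..0}" "q \<in> {-pi..pi}"
  shows "h (-pi, p) \<le> h (q, p)"
proof (cases "q \<le> 0")
  case True
  then show ?thesis using mono[of p "-pi" q] assms by auto
next
  case False
  then show ?thesis using antimono[of p q pi] periodic[of p] assms by auto
qed

text \<open>If \<open>h(\<cdot>,p)\<close> attains its trough value before the trough line, it is constant from there on, and
  the strong maximum principle for a small shift in \<open>q\<close> propagates this to the surface.\<close>

lemma trough_strict:
  assumes p: "p \<in> {p0<..0}" and q: "0 \<le> q" "q < pi"
  shows "h (-pi, p) < h (q, p)"
proof (cases "p = 0")
  case True
  then show ?thesis using trough[of q] q by simp
next
  case False
  then have p': "p0 < p" "p < 0" using p by auto
  show ?thesis
  proof (rule ccontr)
    assume "\<not> h (-pi, p) < h (q, p)"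
    then have eq: "h (q, p) \<le> h (pi, p)" using periodic[of p] p by auto
    define t where "t = (pi - q) / 2"
    have t: "t > 0" "t < pi" using q by (auto simp: t_def)
    let ?U = "{t<..<pi} \<times> {p0<..<0}" and ?v = "\<lambda>z. h (1 * fst z + - t, snd z) - h z"
    \<comment> \<open>Then \<open>q' - t = q + t / 2\<close> and \<open>q' = pi - t / 2\<close> both
      lie strictly between \<open>q\<close> and \<open>pi\<close>, where \<open>eq\<close> and
      monotonicity leave \<open>h\<close> no room to vary.\<close>
    define q' where "q' = q + 3/2 * t"
    have q': "q' - t > q" "q' < pi" "q' > t" using q t by (auto simp: q'_def t_def field_simps)
    have "h (pi, p) \<le> h (q', p)" "h (q', p) \<le> h (q' - t, p)" "h (q' - t, p) \<le> h (q, p)"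
      using antimono[of p q' pi] antimono[of p "q' - t" q'] antimono[of p q "q' - t"] q' q p' t by auto
    then have z0: "?v (q', p) = 0" using eq by simp
    have v0: "?v z = 0" if "z \<in> ?U" for z
    proof (rule strong_maximum_principle[OF K(1)])
      show "open ?U" by (simp add: open_Times)
      show "connected ?U" by (intro convex_connected convex_Times) auto
      show "ell K ?U ?v" by (rule ell_difference) (use t in auto)
      show "0 \<le> ?v x" if "x \<in> ?U" for x
        using antimono[of "snd x" "fst x - t" "fst x"] that t by auto
      show "(q', p) \<in> ?U" using q' p' by simp
    qed (use z0 that in auto)
    have "continuous_on ({t..pi} \<times> {p0..0}) ?v"
      by (intro continuous_on_diff continuous_on_compose2[OF cont_h] continuous_intros) (use t in auto)
    then have "?v (pi, 0) = 0"
      by (rule zero_on_closed_box) (use t p0 v0 in auto)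
    then have "h (pi - t, 0) = h (-pi, 0)" using periodic[of 0] p0 by simp
    then show False using trough[of "pi - t"] t by auto
  qed
qed

section \<open>Positivity of the reflected difference\<close>

definition "W l z = h (2 * l - fst z, snd z) - h z"

definition "good l \<longleftrightarrow> (\<forall>z\<in>{-pi..l} \<times> {p0..0}. 0 \<le> W l z)"

lemma ell_W:
  assumes "- pi / 2 \<le> l" "l \<le> 0"
  shows "ell K ({-pi<..<l} \<times> {p0<..<0}) (W l)"
proof -
  have "ell K ({-pi<..<l} \<times> {p0<..<0}) (\<lambda>z. h (- 1 * fst z + 2 * l, snd z) - h z)"
    by (rule ell_difference) (use assms in auto)
  then show ?thesis by (simp add: W_def[abs_def])
qed

lemma deriv_W:
  assumes l: "- pi / 2 \<le> l" "l \<le> 0" and z: "z \<in> {-pi..l} \<times> {p0..0}"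
  shows "(W l has_derivative plane (- h1 (2 * l - fst z, snd z) - h1 z) (h2 (2 * l - fst z, snd z) - h2 z))
    (at z within {-pi..l} \<times> {p0..0})"
proof -
  let ?C = "{-pi..l} \<times> {p0..0}"
  have "((\<lambda>z. h (- 1 * fst z + 2 * l, snd z)) has_derivative
     plane (- 1 * h1 (- 1 * fst z + 2 * l, snd z)) (h2 (- 1 * fst z + 2 * l, snd z))) (at z within ?C)"
    by (rule has_derivative_flip_shift[OF dh]) (use l z in auto)
  moreover have "(h has_derivative plane (h1 z) (h2 z)) (at z within ?C)"
    by (rule has_derivative_subset[OF dh]) (use l z in auto)
  ultimately have "((\<lambda>z. h (- 1 * fst z + 2 * l, snd z) - h z) has_derivative
     (\<lambda>v. plane (- 1 * h1 (- 1 * fst z + 2 * l, snd z)) (h2 (- 1 * fst z + 2 * l, snd z)) v - plane (h1 z) (h2 z) v)) (at z within ?C)"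
    by (rule has_derivative_diff)
  then show ?thesis by (simp add: W_def[abs_def] plane_def[abs_def] algebra_simps)
qed

lemma cont_W:
  assumes "- pi / 2 \<le> l" "l \<le> 0"
  shows "continuous_on ({-pi..l} \<times> {p0..0}) (W l)"
  by (rule has_derivative_continuous_on) (rule deriv_W[OF assms])

text \<open>Continuity carries the zero from the open rectangle to its closure, where it can collide
  with information known only on the boundary.\<close>

lemma W_zero_propagates:
  assumes l: "- pi / 2 \<le> l" "l \<le> 0" and good: "good l"
    and x: "x \<in> {-pi<..<l} \<times> {p0<..<0}" "W l x = 0" and z: "z \<in> {-pi..l} \<times> {p0..0}"
  shows "W l z = 0"
proof (rule zero_on_closed_box[OF cont_W[OF l] _ _ _ z])
  show "-pi < l" using x by auto
  show "p0 < 0" by (rule p0)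
  show "W l y = 0" if "y \<in> {-pi<..<l} \<times> {p0<..<0}" for y
  proof (rule strong_maximum_principle[OF K(1) _ _ ell_W[OF l] _ x that])
    show "open ({-pi<..<l} \<times> {p0<..<0})" by (simp add: open_Times)
    show "connected ({-pi<..<l} \<times> {p0<..<0})" by (intro convex_connected convex_Times) auto
    show "0 \<le> W l x" if "x \<in> {-pi<..<l} \<times> {p0<..<0}" for x
      using good that unfolding good_def by auto
  qed
qed

text \<open>Hopf's lemma for a ball inside the rectangle that may touch one of its sides; the
  conclusion is the derivative of \<open>W l\<close> towards the centre. It serves the surface and
  the crest line alike.\<close>

lemma W_deriv_pos:
  assumes l: "- pi / 2 \<le> l" "l \<le> 0" and good: "good l"
    and pos: "\<And>z. z \<in> {-pi<..<l} \<times> {p0<..<0} \<Longrightarrow> 0 < W l z" and R: "R > 0"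
    and box: "{c1 - R..c1 + R} \<subseteq> {-pi..l}" "{c2 - R..c2 + R} \<subseteq> {p0..0}"
    and x: "(q, p) \<in> sphere (c1, c2) R" "W l (q, p) = 0"
  shows "0 < (- h1 (2 * l - q, p) - h1 (q, p)) * (c1 - q) + (h2 (2 * l - q, p) - h2 (q, p)) * (c2 - p)"
proof -
  let ?C = "{-pi..l} \<times> {p0..0}" and ?U = "{-pi<..<l} \<times> {p0<..<0}"
  have cb: "cball (c1, c2) R \<subseteq> ?C" using cball_subset_box[of c1 c2 R] box by blast
  have "{c1 - R<..<c1 + R} \<subseteq> {-pi<..<l}" "{c2 - R<..<c2 + R} \<subseteq> {p0<..<0}"
    using box R by auto
  then have bb: "ball (c1, c2) R \<subseteq> ?U" using ball_subset_box[of c1 c2 R] by blast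
  have xC: "(q, p) \<in> ?C" using x(1) cb sphere_cball by blast
  let ?w' = "plane (- h1 (2 * l - q, p) - h1 (q, p)) (h2 (2 * l - q, p) - h2 (q, p))"
  have "0 < ?w' ((c1, c2) - (q, p))"
  proof (rule hopf_derivative[where w = "W l", OF K(1) R _ _ _ _ x])
    show "continuous_on (cball (c1, c2) R) (W l)" by (rule continuous_on_subset[OF cont_W[OF l] cb])
    show "ell K (ball (c1, c2) R) (W l)" by (rule ell_subset[OF ell_W[OF l] bb])
    show "0 \<le> W l y" if "y \<in> cball (c1, c2) R" for y using good cb that unfolding good_def by blast
    show "0 < W l y" if "y \<in> ball (c1, c2) R" for y using pos bb that by blast
    show "(W l has_derivative ?w') (at (q, p) within cball (c1, c2) R)"
      using has_derivative_subset[OF deriv_W[OF l xC] cb] by simp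
  qed
  then show ?thesis by (simp add: plane_def)
qed

text \<open>A zero would spread to the corner \<open>(-pi, 0)\<close>, where \<open>W l\<close>
  compares the surface at \<open>2 * l + pi\<close> with the trough. For \<open>l < 0\<close> the
  former point is not a trough, so the value there is positive.\<close>

lemma W_pos_interior:
  assumes l: "- pi / 2 \<le> l" "l < 0" and good: "good l" and z: "z \<in> {-pi<..<l} \<times> {p0<..<0}"
  shows "0 < W l z"
proof (rule ccontr)
  assume "\<not> 0 < W l z"
  moreover have "0 \<le> W l z" using good z unfolding good_def by auto
  ultimately have "W l z = 0" by simp
  then have "W l (-pi, 0) = 0"
    by (rule W_zero_propagates[rotated 4]) (use l good z p0 in auto)
  then show False using trough[of "2 * l + pi"] l by (simp add: W_def)
qed

text \<open>An interior zero on the surface would be a critical point: the surface condition turns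
  \<open>W\<^sub>q = 0\<close> into \<open>W\<^sub>p = 0\<close>, contradicting Hopf's lemma.\<close>

lemma W_pos_surface:
  assumes l: "- pi / 2 \<le> l" "l < 0" and good: "good l" and q: "-pi < q" "q < l"
  shows "0 < W l (q, 0)"
proof (rule ccontr)
  assume "\<not> 0 < W l (q, 0)"
  moreover have "0 \<le> W l (q, 0)" using good q p0 unfolding good_def by auto
  ultimately have W0: "W l (q, 0) = 0" by simp
  have l': "l \<le> 0" using l by simp
  have qC: "(q, 0) \<in> {-pi..l} \<times> {p0..0}" using q p0 by auto
  define e where "e = min (q + pi) (l - q)"
  have e: "e > 0" using q by (simp add: e_def)
  let ?D = "- h1 (2 * l - q, 0) - h1 (q, 0)"
  have "((\<lambda>u. W l (u, 0)) has_real_derivative ?D) (at q within {-pi..l})"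
    by (rule has_derivative_fst_line) (use deriv_W[OF l(1) l' qC] p0 in auto)
  moreover have "at q within {-pi..l} = at q" by (rule at_within_interior) (use q in auto)
  ultimately have "((\<lambda>u. W l (u, 0)) has_real_derivative ?D) (at q)" by simp
  then have D0: "?D = 0"
  proof (rule DERIV_local_min[OF _ e])
    show "\<forall>u. \<bar>q - u\<bar> < e \<longrightarrow> W l (q, 0) \<le> W l (u, 0)"
    proof (intro allI impI)
      fix u assume "\<bar>q - u\<bar> < e"
      then have "(u, 0) \<in> {-pi..l} \<times> {p0..0}" using p0 by (auto simp: e_def)
      then show "W l (q, 0) \<le> W l (u, 0)" using good W0 unfolding good_def by metis
    qed
  qed
  have heq: "h (2 * l - q, 0) = h (q, 0)" using W0 by (simp add: W_def)
  \<comment> \<open>Both surface conditions have the same factor \<open>X\<close>, as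
    \<open>h\<close> agrees at \<open>q\<close> and its reflection. It is nonzero because
    \<open>1 + h1\<^sup>2\<close> is positive, so it can be cancelled.\<close>
  define X where "X = r0 * h (q, 0) - Q"
  have s1: "1 + (h1 (q, 0))\<^sup>2 + (h2 (q, 0))\<^sup>2 * X = 0"
    unfolding X_def by (rule surface) (use q l in auto)
  have s2: "1 + (h1 (2 * l - q, 0))\<^sup>2 + (h2 (2 * l - q, 0))\<^sup>2 * X = 0"
    unfolding X_def heq[symmetric] by (rule surface) (use q l in auto)
  have "h1 (2 * l - q, 0) = - h1 (q, 0)" using D0 by simp
  then have "(h1 (2 * l - q, 0))\<^sup>2 = (h1 (q, 0))\<^sup>2" by simp
  then have "(h2 (q, 0))\<^sup>2 * X = (h2 (2 * l - q, 0))\<^sup>2 * X" using s1 s2 by linarith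
  moreover have "X \<noteq> 0"
  proof
    assume "X = 0"
    then show False using s1 zero_le_power2[of "h1 (q, 0)"] by simp
  qed
  ultimately have "(h2 (q, 0))\<^sup>2 = (h2 (2 * l - q, 0))\<^sup>2" by simp
  moreover have "\<nu> \<le> h2 (q, 0)" "\<nu> \<le> h2 (2 * l - q, 0)" using q l p0 by (auto intro!: h2_lower)
  ultimately have D2: "h2 (q, 0) = h2 (2 * l - q, 0)" using \<nu> by (simp add: power2_eq_iff_nonneg)
  \<comment> \<open>The ball about \<open>(q, - R)\<close> is tangent to the surface at
    \<open>(q, 0)\<close>: \<open>e\<close> limits it sideways, \<open>- p0\<close> downwards. The
    direction towards its centre is vertical, so only \<open>D2\<close> matters.\<close>
  define R where "R = min e (- p0) / 2"
  have R: "R > 0" "R < e" "2 * R \<le> - p0" using e p0 by (auto simp: R_def)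
  have "0 < ?D * (q - q) + (h2 (2 * l - q, 0) - h2 (q, 0)) * (- R - 0)"
  proof (rule W_deriv_pos[OF l(1) l' good])
    show "0 < W l z" if "z \<in> {-pi<..<l} \<times> {p0<..<0}" for z by (rule W_pos_interior[OF l good that])
    show "R > 0" by (rule R)
    show "{q - R..q + R} \<subseteq> {-pi..l}" using R(2) by (auto simp: e_def)
    show "{- R - R..- R + R} \<subseteq> {p0..0}" using R by auto
    show "(q, 0) \<in> sphere (q, - R) R" using R by (simp add: dist_Pair_Pair dist_real_def)
    show "W l (q, 0) = 0" by (rule W0)
  qed
  then show False using D2 by simp
qed

text \<open>Reflection sends \<open>-pi\<close> to \<open>2 * l + pi\<close>, which for these
  \<open>l\<close> lies in \<open>[0, pi)\<close>, the range of
  \<open>trough_strict\<close>.\<close>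

lemma W_pos_trough:
  assumes l: "- pi / 2 \<le> l" "l < 0" and p: "p \<in> {p0<..0}"
  shows "0 < W l (-pi, p)"
  using trough_strict[OF p, of "2 * l + pi"] l by (simp add: W_def)

section \<open>Continuation in \<open>l\<close> up to the crest line\<close>

lemma good_right_open:
  assumes l: "- pi / 2 \<le> l" "l < 0" and good: "good l"
  obtains \<epsilon> where "\<epsilon> > 0" "\<And>m. l < m \<Longrightarrow> m < l + \<epsilon> \<Longrightarrow> m \<le> 0 \<Longrightarrow> good m"
proof -
  \<comment> \<open>The first bound is the thinness required by the strip principle, the second
    keeps the strip below the surface.\<close>
  define \<delta> where "\<delta> = min (1 / (4 * K)) (- p0 / 2)"
  have \<delta>: "0 < \<delta>" "\<delta> \<le> 1 / (4 * K)" "p0 + \<delta> < 0" using K(1) p0 by (auto simp: \<delta>_def)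
  \<comment> \<open>Since \<open>l < 0\<close>, the side \<open>q = 3/2 * l\<close> stays away from
    the reflection line \<open>q = l\<close>, and the lower side stays away from the bed; on both
    excluded lines \<open>W l\<close> vanishes.\<close>
  let ?X = "{-pi..3/2 * l} \<times> {p0 + \<delta>..0}"
  have "compact ?X" by (intro compact_Times compact_Icc)
  moreover have "?X \<noteq> {}" using \<delta>(3) l pi_gt_zero by auto
  moreover have "continuous_on ?X (W l)"
    by (rule continuous_on_subset[OF cont_W]) (use l \<delta> in auto)
  ultimately obtain x where x: "x \<in> ?X" "\<And>y. y \<in> ?X \<Longrightarrow> W l x \<le> W l y"
    using continuous_attains_inf[of ?X "W l"] by metis
  have Wx: "W l x > 0"
  proof -
    obtain q p where qp: "x = (q, p)" by fastforce
    have q: "-pi \<le> q" "q < l" and p: "p0 < p" "p \<le> 0" using x(1) l \<delta> by (auto simp: qp)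
    show ?thesis
      using W_pos_interior[OF l good, of x] W_pos_surface[OF l good, of q] W_pos_trough[OF l, of p] q p
      unfolding qp by (cases "q = -pi"; cases "p = 0") auto
  qed
  obtain e where e: "e > 0" "\<And>q q' p. q \<in> {-pi..pi} \<Longrightarrow> q' \<in> {-pi..pi} \<Longrightarrow> p \<in> {p0..0} \<Longrightarrow>
    \<bar>q' - q\<bar> < e \<Longrightarrow> \<bar>h (q', p) - h (q, p)\<bar> < W l x"
    using uniform_h[OF Wx] by blast
  show thesis
  proof
    \<comment> \<open>The bound \<open>- l / 4\<close> gives \<open>m < 3/4 * l\<close>, so that
      \<open>2 * m - q > 0\<close> forces \<open>q < 3/2 * l\<close>. The bound \<open>e / 2\<close>
      keeps the reflected points for \<open>m\<close> and \<open>l\<close>, which differ by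
      \<open>2 * (m - l)\<close>, within \<open>e\<close>.\<close>
    show "min (e / 2) (- l / 4) > 0" using e l by simp
    fix m assume m: "l < m" "m < l + min (e / 2) (- l / 4)" "m \<le> 0"
    have m34: "m < 3/4 * l" "2 * (m - l) < e" using m by auto
    have m': "- pi / 2 \<le> m" using m l by simp
    have top: "0 \<le> W m (q, p)" if q: "q \<in> {-pi..m}" and p: "p \<in> {p0 + \<delta>..0}" for q p
    proof (cases "2 * m - q \<le> 0")
      case True
      then show ?thesis using mono[of p q "2 * m - q"] q p \<delta> by (auto simp: W_def)
    next
      case False
      then have "q < 3/2 * l" using m34 by simp
      then have "W l x \<le> W l (q, p)" using q p by (intro x(2)) auto
      moreover have "\<bar>h (2 * m - q, p) - h (2 * l - q, p)\<bar> < W l x"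
        by (rule e(2)) (use q p \<delta> m m34 l \<open>q < 3/2 * l\<close> in auto)
      ultimately show ?thesis by (simp add: W_def)
    qed
    have bottom: "0 \<le> W m z" if "z \<in> {-pi..m} \<times> {p0..p0 + \<delta>}" for z
    proof (rule thin_strip_maximum_principle[OF K(1) \<delta>(1,2) _ _ _ _ that])
      show "-pi < m" using m' pi_gt_zero by linarith
      show "continuous_on ({-pi..m} \<times> {p0..p0 + \<delta>}) (W m)"
        by (rule continuous_on_subset[OF cont_W[OF m' m(3)]]) (use \<delta> in auto)
      show "ell K ({-pi<..<m} \<times> {p0<..<p0 + \<delta>}) (W m)"
        by (rule ell_subset[OF ell_W[OF m' m(3)]]) (use \<delta> in auto)
      show "0 \<le> W m (q, p)" if q: "q \<in> {-pi..m}" and p: "p \<in> {p0..p0 + \<delta>}"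
        and bd: "q = -pi \<or> q = m \<or> p = p0 \<or> p = p0 + \<delta>" for q p
      proof -
        consider "q = -pi" | "q = m" | "p = p0" | "p = p0 + \<delta>" using bd by blast
        then show ?thesis
        proof cases
          case 1
          have "h (-pi, p) \<le> h (2 * m + pi, p)" by (rule min_at_trough) (use p \<delta> m' m in auto)
          then show ?thesis using 1 by (simp add: W_def)
        next
          case 2
          then show ?thesis by (simp add: W_def)
        next
          case 3
          have "h (2 * m - q, p0) = 0" "h (q, p0) = 0" by (rule bed, use q m m' in simp)+
          then show ?thesis using 3 by (simp add: W_def)
        next
          case 4
          then show ?thesis using top[OF q, of p] \<delta> by simp
        qed
      qed
    qed
    show "good m" unfolding good_def
    proof
      fix z assume z: "z \<in> {-pi..m} \<times> {p0..0}"
      show "0 \<le> W m z"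
        using top[of "fst z" "snd z"] bottom[of z] z by (cases "snd z \<le> p0 + \<delta>") (auto simp: mem_Times_iff)
    qed
  qed
qed

lemma good_start: "good (- pi / 2)"
  unfolding good_def W_def using mono by auto

text \<open>The supremum \<open>L\<close> of the admissible \<open>l\<close> is admissible by
  continuity of \<open>W\<close> in \<open>l\<close>; were it negative, admissibility would extend
  beyond it.\<close>

lemma good_0: "good 0"
proof -
  define S where "S = {l \<in> {- pi / 2..0}. good l}"
  have S: "- pi / 2 \<in> S" "bdd_above S" using good_start by (auto simp: S_def intro: bdd_aboveI[of _ 0])
  define L where "L = Sup S"
  have L1: "- pi / 2 \<le> L" unfolding L_def using S by (rule cSup_upper)
  have L2: "L \<le> 0" unfolding L_def
  proof (rule cSup_least)
    show "S \<noteq> {}" using S(1) by blast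
  qed (simp add: S_def)
  have "good L" unfolding good_def
  proof
    fix z assume "z \<in> {-pi..L} \<times> {p0..0}"
    then obtain q p where z: "z = (q, p)" "q \<in> {-pi..L}" "p \<in> {p0..0}" by blast
    show "0 \<le> W L z"
    proof (rule ccontr)
      assume neg: "\<not> 0 \<le> W L z"
      then have "q \<noteq> L" by (auto simp: z W_def)
      then have qL: "q < L" using z by simp
      have "- W L z > 0" using neg by simp
      then obtain e where e: "e > 0" "\<And>q q' p. q \<in> {-pi..pi} \<Longrightarrow> q' \<in> {-pi..pi} \<Longrightarrow> p \<in> {p0..0} \<Longrightarrow>
        \<bar>q' - q\<bar> < e \<Longrightarrow> \<bar>h (q', p) - h (q, p)\<bar> < - W L z"
        using uniform_h by blast
      \<comment> \<open>An \<open>l\<close> beyond \<open>q\<close> keeps the bad point in the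
        rectangle for \<open>l\<close>; one beyond \<open>L - e / 2\<close> moves its reflection by
        less than \<open>e\<close>.\<close>
      have "max q (L - e / 2) < Sup S" using qL e(1) by (simp add: L_def[symmetric])
      then obtain l where l: "l \<in> S" "max q (L - e / 2) < l"
        using less_cSup_iff[of S] S by blast
      have lL: "l \<le> L" unfolding L_def using l(1) S(2) by (rule cSup_upper)
      have "\<bar>h (2 * l - q, p) - h (2 * L - q, p)\<bar> < - W L z"
        by (rule e(2)) (use z qL l lL L2 L1 pi_gt_zero in auto)
      then have "W l z < 0" by (simp add: W_def z)
      moreover have "0 \<le> W l z"
        using l z by (simp add: S_def good_def)
      ultimately show False by simp
    qed
  qed
  moreover have "L = 0"
  proof (rule ccontr)
    assume "L \<noteq> 0"
    then have "L < 0" using L2 by simp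
    then obtain \<epsilon> where \<epsilon>: "\<epsilon> > 0" "\<And>m. L < m \<Longrightarrow> m < L + \<epsilon> \<Longrightarrow> m \<le> 0 \<Longrightarrow> good m"
      using good_right_open[OF L1 _ \<open>good L\<close>] by blast
    define m where "m = min 0 (L + \<epsilon> / 2)"
    have "good m" by (rule \<epsilon>(2)) (use \<epsilon> \<open>L < 0\<close> in \<open>auto simp: m_def\<close>)
    then have "m \<in> S" using \<epsilon> \<open>L < 0\<close> L1 by (auto simp: S_def m_def)
    then have "m \<le> L" unfolding L_def using S(2) by (rule cSup_upper)
    then show False using \<epsilon> \<open>L < 0\<close> by (simp add: m_def min_def split: if_splits)
  qed
  ultimately show ?thesis by simp
qed

text \<open>The crest hypothesis gives \<open>W\<^sub>q = -2 h\<^sub>q = 0\<close> on the whole crest line, so Hopf's lemma there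
  excludes \<open>W > 0\<close>.\<close>

lemma W_0_eq_0:
  assumes "z \<in> {-pi..0} \<times> {p0..0}"
  shows "W 0 z = 0"
proof (rule ccontr)
  assume ne: "W 0 z \<noteq> 0"
  have l: "- pi / 2 \<le> 0" "(0::real) \<le> 0" by auto
  have pos: "0 < W 0 y" if "y \<in> {-pi<..<0} \<times> {p0<..<0}" for y
  proof -
    have "W 0 y \<noteq> 0" using W_zero_propagates[OF l good_0 that _ assms] ne by blast
    moreover have "0 \<le> W 0 y" using good_0 that unfolding good_def by auto
    ultimately show ?thesis by simp
  qed
  define p where "p = p0 / 2"
  have p: "p0 < p" "p < 0" using p0 by (auto simp: p_def)
  have "((\<lambda>u. h (u, p)) has_real_derivative h1 (0, p)) (at 0)"
    by (rule has_derivative_fst_line[OF dh_interior]) (use p in auto)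
  then have crest: "h1 (0, p) = 0"
  proof (rule DERIV_local_max[OF _ pi_gt_zero])
    show "\<forall>u. \<bar>0 - u\<bar> < pi \<longrightarrow> h (u, p) \<le> h (0, p)"
    proof (intro allI impI)
      fix u assume "\<bar>0 - u\<bar> < pi"
      then show "h (u, p) \<le> h (0, p)"
        using mono[of p u 0] antimono[of p 0 u] p by (cases "u \<le> 0") auto
    qed
  qed
  \<comment> \<open>The ball about \<open>(- R, p)\<close> is tangent to the crest line at
    \<open>(0, p)\<close>. It fits because \<open>p\<close> is at mid-depth and
    \<open>2 * R \<le> 2 < pi\<close>.\<close>
  define R where "R = min 1 (- p0 / 2)"
  have R: "R > 0" "R \<le> 1" "R \<le> - p0 / 2" using p0 by (auto simp: R_def)
  have "0 < (- h1 (2 * 0 - 0, p) - h1 (0, p)) * (- R - 0) + (h2 (2 * 0 - 0, p) - h2 (0, p)) * (p - p)"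
  proof (rule W_deriv_pos[OF l good_0 pos R(1)])
    show "{- R - R..- R + R} \<subseteq> {-pi..0}" using R pi_gt3 by auto
    show "{p - R..p + R} \<subseteq> {p0..0}" using R by (auto simp: p_def)
    show "(0, p) \<in> sphere (- R, p) R" using R by (simp add: dist_Pair_Pair dist_real_def)
    show "W 0 (0, p) = 0" by (simp add: W_def)
  qed
  then show False using crest by simp
qed

lemma symmetric:
  assumes "q \<in> {-pi..pi}" "p \<in> {p0..0}"
  shows "h (- q, p) = h (q, p)"
proof (cases "q \<le> 0")
  case True
  then show ?thesis using W_0_eq_0[of "(q, p)"] assms by (simp add: W_def)
next
  case False
  then show ?thesis using W_0_eq_0[of "(- q, p)"] assms by (simp add: W_def)
qed

end

section \<open>Compactness bounds and reduction to the classical setting\<close>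

lemma continuous_on_compact_bounded:
  fixes f :: "'a::metric_space \<Rightarrow> real"
  assumes "compact S" "continuous_on S f"
  obtains C where "\<And>x. x \<in> S \<Longrightarrow> \<bar>f x\<bar> \<le> C"
proof -
  have "bounded (f ` S)" using assms compact_continuous_image compact_imp_bounded by blast
  then show thesis using that unfolding bounded_iff by auto
qed

theorem theorem3p1:
  fixes \<alpha> p0 g Q :: real
    and \<rho> \<beta> :: "real \<Rightarrow> real"
    and h :: "real \<times> real \<Rightarrow> real"
  assumes "0 < \<alpha>" "\<alpha> < 1"
    and "p0 < 0"
    and "holder_on 1 \<alpha> {p0..0} \<rho>"
    and "\<And>p. p \<in> {p0..0} \<Longrightarrow> \<rho> p > 0"
    and "antimono_on {p0..0} \<rho>"
    and "holder_on 0 \<alpha> {0..\<bar>p0\<bar>} \<beta>"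
    and "g > 0"
    and "holder_on 2 \<alpha> (closure (D p0)) h"
    and "\<And>q p. p \<in> {p0..0} \<Longrightarrow> h (q + 2 * pi, p) = h (q, p)"
    and "\<And>z. z \<in> closure (D p0) \<Longrightarrow> dp p0 h z > 0"
    and "height_problem p0 \<rho> \<beta> g Q h"
    and "\<And>p. p \<in> {p0..0} \<Longrightarrow> mono_on {-pi..0} (\<lambda>q. h (q, p))"
    and "\<And>p. p \<in> {p0..0} \<Longrightarrow> antimono_on {0..pi} (\<lambda>q. h (q, p))"
    and "\<And>q. -pi < q \<Longrightarrow> q < pi \<Longrightarrow> h (-pi, 0) < h (q, 0) \<and> h (pi, 0) < h (q, 0)"
  shows "\<forall>q\<in>{-pi..pi}. \<forall>p\<in>{p0..0}. h (-q, p) = h (q, p)"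
proof -
  let ?R = "{-pi..pi} \<times> {p0..0}" and ?O = "{-pi<..<pi} \<times> {p0<..<0}"
  have cl: "closure (D p0) = ?R" by (rule closure_D[OF assms(3)])
  have cR: "compact ?R" by (intro compact_Times compact_Icc)
  have OR: "z \<in> ?R" if "z \<in> ?O" for z using that by auto
  have at: "at z within ?R = at z" if "z \<in> ?O" for z
    by (rule at_within_interior) (use that in \<open>simp add: interior_Times\<close>)
  have basis: "(1, 0) \<in> (Basis :: (real \<times> real) set)" "(0, 1) \<in> (Basis :: (real \<times> real) set)"
    by (auto simp: Basis_prod_def)
  have h2': "holder_on (Suc (Suc 0)) \<alpha> ?R h" using assms(9) by (simp only: cl numeral_2_eq_2)
  have dh: "h differentiable_on ?R" using h2' by simp
  have step: "f differentiable_on ?R" "holder_on 0 \<alpha> ?R (dq p0 f)" "holder_on 0 \<alpha> ?R (dp p0 f)"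
    if "f = dq p0 h \<or> f = dp p0 h" for f
    using that h2' basis unfolding holder_on.simps(2) dq_def dp_def cl by blast+
  have D: "(f has_derivative plane (dq p0 f z) (dp p0 f z)) (at z within ?R)"
    if "f differentiable_on ?R" "z \<in> ?R" for f z
    using differentiable_on_has_derivative_plane[OF that] by (simp add: dq_def dp_def cl)
  note D0 = D[OF dh] and D1 = D[OF step(1)[OF disjI1[OF refl]]] and D2 = D[OF step(1)[OF disjI2[OF refl]]]
  have second: "continuous_on ?R (dq p0 f)" "continuous_on ?R (dp p0 f)" if "f = dq p0 h \<or> f = dp p0 h" for f
    using step(2,3)[OF that] holder_on_0_continuous_on[OF assms(1)] by blast+
  have first: "continuous_on ?R h" "continuous_on ?R (dq p0 h)" "continuous_on ?R (dp p0 h)"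
    using dh step(1) by (auto intro: differentiable_imp_continuous_on)
  \<comment> \<open>The height equation contains only \<open>dp p0 (dq p0 h)\<close>, whereas
    differentiating \<open>dp p0 h\<close> in \<open>q\<close> produces the other order; the
    symmetric Hessian needs them equal.\<close>
  have mixed: "dp p0 (dq p0 h) z = dq p0 (dp p0 h) z" if z: "z \<in> ?O" for z
  proof (rule mixed_derivatives_eq[where U = ?O and f = h and ?f1.0 = "dq p0 h" and ?f2.0 = "dp p0 h"])
    show "open ?O" by (simp add: open_Times)
    show "(h has_derivative plane (dq p0 h y) (dp p0 h y)) (at y)" if "y \<in> ?O" for y
      using D0[OF OR[OF that]] unfolding at[OF that] .
    show "(dq p0 h has_derivative plane (dq p0 (dq p0 h) y) (dp p0 (dq p0 h) y)) (at y)" if "y \<in> ?O" for y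
      using D1[OF OR[OF that]] unfolding at[OF that] .
    show "(dp p0 h has_derivative plane (dq p0 (dp p0 h) y) (dp p0 (dp p0 h) y)) (at y)" if "y \<in> ?O" for y
      using D2[OF OR[OF that]] unfolding at[OF that] .
    show "continuous (at z) (dp p0 (dq p0 h))" "continuous (at z) (dq p0 (dp p0 h))"
      using second(2)[OF disjI1[OF refl]] second(1)[OF disjI2[OF refl]] OR[OF z] at[OF z]
      unfolding continuous_on_eq_continuous_within by metis+
  qed (rule z)
  have "continuous_on {p0..0} (partial_within {p0..0} 1 \<rho>)" and d\<rho>: "\<rho> differentiable_on {p0..0}"
    using assms(4) holder_on_0_continuous_on[OF assms(1)] by (auto simp: One_nat_def)
  then obtain B1 where B1: "\<And>p. p \<in> {p0..0} \<Longrightarrow> \<bar>partial_within {p0..0} 1 \<rho> p\<bar> \<le> B1"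
    using continuous_on_compact_bounded[OF compact_Icc] by metis
  \<comment> \<open>The bound \<open>B1\<close> comes from the derivative up to the endpoints, which
    is continuous on a compact interval; this equality transfers it to the \<open>deriv\<close> of
    the equation.\<close>
  have deriv_\<rho>: "deriv \<rho> p = partial_within {p0..0} 1 \<rho> p" if p: "p \<in> {p0<..<0}" for p
  proof -
    have atp: "at p within {p0..0} = at p" by (rule at_within_interior) (use p in simp)
    have "\<rho> differentiable (at p)"
      using d\<rho> p atp unfolding differentiable_on_def by (metis atLeastAtMost_iff greaterThanLessThan_iff less_imp_le)
    then have F: "(\<rho> has_derivative frechet_derivative \<rho> (at p)) (at p)"
      by (simp add: frechet_derivative_works)
    have "(\<rho> has_real_derivative frechet_derivative \<rho> (at p) 1) (at p)"
      unfolding has_field_derivative_def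
    proof (rule has_derivative_eq_rhs[OF F], rule ext)
      fix x
      show "frechet_derivative \<rho> (at p) x = frechet_derivative \<rho> (at p) 1 * x"
        using linear_cmul[OF has_derivative_linear[OF F], of x 1] by (simp add: mult.commute)
    qed
    then show ?thesis unfolding partial_within_def atp by (rule DERIV_imp_deriv)
  qed
  obtain B2 where B2: "\<And>p. p \<in> {0..\<bar>p0\<bar>} \<Longrightarrow> \<bar>\<beta> p\<bar> \<le> B2"
    using continuous_on_compact_bounded[OF compact_Icc holder_on_0_continuous_on[OF assms(1,7)]] by metis
  have "continuous_on ?R (\<lambda>z. h z - mean_depth h)" by (intro continuous_on_diff first continuous_on_const)
  then obtain C0 where C0: "\<And>z. z \<in> ?R \<Longrightarrow> \<bar>h z - mean_depth h\<bar> \<le> C0"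
    using continuous_on_compact_bounded[OF cR] by metis
  obtain C1 where C1: "\<And>z. z \<in> ?R \<Longrightarrow> \<bar>dq p0 h z\<bar> \<le> C1"
    using continuous_on_compact_bounded[OF cR first(2)] by metis
  obtain C2 where C2: "\<And>z. z \<in> ?R \<Longrightarrow> \<bar>dp p0 h z\<bar> \<le> C2"
    using continuous_on_compact_bounded[OF cR first(3)] by metis
  obtain C3 where C3: "\<And>z. z \<in> ?R \<Longrightarrow> \<bar>dq p0 (dq p0 h) z\<bar> \<le> C3"
    using continuous_on_compact_bounded[OF cR second(1)[OF disjI1[OF refl]]] by metis
  obtain C4 where C4: "\<And>z. z \<in> ?R \<Longrightarrow> \<bar>dp p0 (dq p0 h) z\<bar> \<le> C4"
    using continuous_on_compact_bounded[OF cR second(2)[OF disjI1[OF refl]]] by metis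
  obtain C5 where C5: "\<And>z. z \<in> ?R \<Longrightarrow> \<bar>dp p0 (dp p0 h) z\<bar> \<le> C5"
    using continuous_on_compact_bounded[OF cR second(2)[OF disjI2[OF refl]]] by metis
  define B where "B = Max {1, g * B1, B2, C0, C1, C2, C3, C4, C5}"
  have B: "1 \<le> B" "g * B1 \<le> B" "B2 \<le> B" "C0 \<le> B" "C1 \<le> B" "C2 \<le> B" "C3 \<le> B" "C4 \<le> B" "C5 \<le> B"
    unfolding B_def by (rule Max_ge; simp)+
  have "?R \<noteq> {}" using assms(3) by auto
  \<comment> \<open>Compactness turns the pointwise positivity of \<open>dp p0 h\<close> into the
    uniform lower bound \<open>dp p0 h z0\<close>, which becomes \<open>\<nu>\<close>.\<close>
  then obtain z0 where z0: "z0 \<in> ?R" "\<And>z. z \<in> ?R \<Longrightarrow> dp p0 h z0 \<le> dp p0 h z"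
    using continuous_attains_inf[OF cR _ first(3)] by metis
  have hp: "\<And>z. z \<in> ?O \<Longrightarrow> (1 + (dq p0 h z)\<^sup>2) * dp p0 (dp p0 h) z
        - 2 * dq p0 h z * dp p0 h z * dp p0 (dq p0 h) z + (dp p0 h z)\<^sup>2 * dq p0 (dq p0 h) z
        + (\<beta> (- snd z) - g * (h z - mean_depth h) * deriv \<rho> (snd z)) * dp p0 h z ^ 3 = 0"
    and surf: "\<And>q. q \<in> {-pi..pi} \<Longrightarrow>
        1 + (dq p0 h (q, 0))\<^sup>2 + (dp p0 h (q, 0))\<^sup>2 * (2 * g * \<rho> 0 * h (q, 0) - Q) = 0"
    and bed: "\<And>q. q \<in> {-pi..pi} \<Longrightarrow> h (q, p0) = 0"
    using assms(12) unfolding height_problem_def D_def by fastforce+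
  interpret monotone_wave p0 Q "mean_depth h" "2 * g * \<rho> 0" B "dp p0 h z0" "\<lambda>p. \<beta> (- p)" "\<lambda>p. g * deriv \<rho> p"
    h "dq p0 h" "dp p0 h" "dq p0 (dq p0 h)" "dp p0 (dq p0 h)" "dp p0 (dp p0 h)"
  proof
    show "p0 < 0" "1 \<le> B" by fact+
    show "0 < dp p0 h z0" using assms(11) z0(1) cl by blast
    show "(h has_derivative plane (dq p0 h z) (dp p0 h z)) (at z within ?R)" if "z \<in> ?R" for z
      by (rule D0[OF that])
    show "(dq p0 h has_derivative plane (dq p0 (dq p0 h) z) (dp p0 (dq p0 h) z)) (at z)" if "z \<in> ?O" for z
      using D1[OF OR[OF that]] unfolding at[OF that] .
    show "(dp p0 h has_derivative plane (dp p0 (dq p0 h) z) (dp p0 (dp p0 h) z)) (at z)" if "z \<in> ?O" for z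
      using D2[OF OR[OF that]] unfolding at[OF that] mixed[OF that] .
    show "\<bar>h z - mean_depth h\<bar> \<le> B \<and> \<bar>dq p0 h z\<bar> \<le> B \<and> \<bar>dp p0 h z\<bar> \<le> B \<and> \<bar>dq p0 (dq p0 h) z\<bar> \<le> B \<and>
      \<bar>dp p0 (dq p0 h) z\<bar> \<le> B \<and> \<bar>dp p0 (dp p0 h) z\<bar> \<le> B" if "z \<in> ?O" for z
      using order_trans[OF C0[OF OR[OF that]] B(4)] order_trans[OF C1[OF OR[OF that]] B(5)]
        order_trans[OF C2[OF OR[OF that]] B(6)] order_trans[OF C3[OF OR[OF that]] B(7)]
        order_trans[OF C4[OF OR[OF that]] B(8)] order_trans[OF C5[OF OR[OF that]] B(9)] by blast
    show "\<bar>\<beta> (- p)\<bar> \<le> B \<and> \<bar>g * deriv \<rho> p\<bar> \<le> B" if p: "p \<in> {p0<..<0}" for p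
    proof
      show "\<bar>\<beta> (- p)\<bar> \<le> B" using B2[of "- p"] B(3) p by force
      have "\<bar>g * deriv \<rho> p\<bar> \<le> g * B1"
        unfolding abs_mult deriv_\<rho>[OF p] using B1[of p] p assms(8) by (intro mult_mono) auto
      then show "\<bar>g * deriv \<rho> p\<bar> \<le> B" using B(2) by linarith
    qed
    show "dp p0 h z0 \<le> dp p0 h z" if "z \<in> ?R" for z by (rule z0(2)[OF that])
    show "(1 + (dq p0 h z)\<^sup>2) * dp p0 (dp p0 h) z
        - 2 * dq p0 h z * dp p0 h z * dp p0 (dq p0 h) z + (dp p0 h z)\<^sup>2 * dq p0 (dq p0 h) z
        + (\<beta> (- snd z) - g * deriv \<rho> (snd z) * (h z - mean_depth h)) * dp p0 h z ^ 3 = 0" if "z \<in> ?O" for z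
      using hp[OF that] by (simp only: mult.assoc mult.commute[of "h z - mean_depth h"])
    show "1 + (dq p0 h (q, 0))\<^sup>2 + (dp p0 h (q, 0))\<^sup>2 * (2 * g * \<rho> 0 * h (q, 0) - Q) = 0" if "q \<in> {-pi..pi}" for q
      by (rule surf[OF that])
    show "h (q, p0) = 0" if "q \<in> {-pi..pi}" for q by (rule bed[OF that])
    show "h (-pi, p) = h (pi, p)" if "p \<in> {p0..0}" for p using assms(10)[OF that, of "-pi"] by simp
    show "h (q, p) \<le> h (q', p)" if "p \<in> {p0..0}" "-pi \<le> q" "q \<le> q'" "q' \<le> 0" for p q q'
      using mono_onD[OF assms(13)[OF that(1)], of q q'] that by auto
    show "h (q', p) \<le> h (q, p)" if "p \<in> {p0..0}" "0 \<le> q" "q \<le> q'" "q' \<le> pi" for p q q'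
      using monotone_onD[OF assms(14)[OF that(1)], of q q'] that by auto
    show "h (-pi, 0) < h (q, 0)" if "-pi < q" "q < pi" for q using assms(15)[OF that] by blast
  qed
  show ?thesis using symmetric by blast
qed

end
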